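(* Let $H$ and $K$ be infinite quasiconvex subgroups of a negatively curved group $G$. Assume that $H$ and $K$ are residually finite. If the intersection of $H$ and $K$ is trivial, then there exist an infinite family of distinct finite index subgroups $H_m$ of $H$ and an infinite family of distinct finite index subgroups $K_n$ of $K$ such that, for all $m$ and $n$, the subgroup $\langle H_m, K_n\rangle$ is quasiconvex in $G$ and $\langle H_m, K_n\rangle = H_m * K_n$.
   Context: $G$ is a group with a fixed finite generating set $X$, and $X^* = \{x, x^{-1} : x \in X\}$. $\mathrm{Cayley}(G)$ is the Cayley graph of $G$ with respect to $X^*$: its vertex set is $G$, its edge set is $G \times X^*$, and the edge $(g,x)$ joins $g$ to $gx$. A geodesic is a shortest path joining two vertices of $\mathrm{Cayley}(G)$. The group $G$ is negatively curved if for some $\delta \ge 0$ it is $\delta$-negatively curved, i.e. any side of any geodesic triangle in $\mathrm{Cayley}(G)$ belongs to the $\delta$-neighborhood of the union of the two other sides. A subgroup $H$ of $G$ is quasiconvex in $G$ if for some $\mu \ge 0$ any geodesic in $\mathrm{Cayley}(G)$ with both endpoints in $H$ belongs to the $\mu$-neighborhood of $H$. A group $K$ is residually finite if for any finite set of non-trivial elements of $K$ there exists a finite index subgroup of $K$ which does not contain any element of this set. $\langle A, B\rangle$ denotes the smallest subgroup of $G$ containing the subgroups $A$ and $B$, and $\langle A, B\rangle = A * B$ means that the natural homomorphism from the free product $A * B$ to $\langle A, B\rangle$, induced by the inclusions, is an isomorphism. *)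

theory Defs
  imports "HOL-Algebra.Coset" "HOL-Algebra.Generated_Groups" "Graph_Theory.Arc_Walk"
begin

section \<open>Cayley graphs, negative curvature and quasiconvexity\<close>

definition symmetrized :: "('a, 'm) monoid_scheme \<Rightarrow> 'a set \<Rightarrow> 'a set" where
  "symmetrized G X = X \<union> m_inv G ` X"

definition cayley_graph :: "('a, 'm) monoid_scheme \<Rightarrow> 'a set \<Rightarrow> ('a, 'a \<times> 'a) pre_digraph" where
  "cayley_graph G X =
    \<lparr> verts = carrier G,
      arcs = carrier G \<times> symmetrized G X,
      tail = (\<lambda>(g, x). g),
      head = (\<lambda>(g, x). g \<otimes>\<^bsub>G\<^esub> x) \<rparr>"

text \<open>
  Every arc (g, x) has the opposite arc (gx, inv x), so the directed walks of this digraph are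
  exactly the edge paths of the undirected Cayley graph.
\<close>

definition cayley_geodesic ::
    "('a, 'm) monoid_scheme \<Rightarrow> 'a set \<Rightarrow> 'a \<Rightarrow> ('a \<times> 'a) awalk \<Rightarrow> 'a \<Rightarrow> bool" where
  "cayley_geodesic G X a p b \<longleftrightarrow>
    pre_digraph.awalk (cayley_graph G X) a p b \<and>
    (\<forall>q. pre_digraph.awalk (cayley_graph G X) a q b \<longrightarrow> length p \<le> length q)"

definition cayley_dist :: "('a, 'm) monoid_scheme \<Rightarrow> 'a set \<Rightarrow> 'a \<Rightarrow> 'a \<Rightarrow> nat" where
  "cayley_dist G X a b =
    (LEAST n. \<exists>p. pre_digraph.awalk (cayley_graph G X) a p b \<and> length p = n)"

definition cayley_nbhd :: "('a, 'm) monoid_scheme \<Rightarrow> 'a set \<Rightarrow> real \<Rightarrow> 'a set \<Rightarrow> 'a set" where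
  "cayley_nbhd G X r S = {v \<in> carrier G. \<exists>s\<in>S. real (cayley_dist G X v s) \<le> r}"

definition path_verts ::
    "('a, 'm) monoid_scheme \<Rightarrow> 'a set \<Rightarrow> 'a \<Rightarrow> ('a \<times> 'a) awalk \<Rightarrow> 'a set" where
  "path_verts G X a p = set (pre_digraph.awalk_verts (cayley_graph G X) a p)"

definition delta_negatively_curved ::
    "('a, 'm) monoid_scheme \<Rightarrow> 'a set \<Rightarrow> real \<Rightarrow> bool" where
  "delta_negatively_curved G X \<delta> \<longleftrightarrow>
    (\<forall>a b c p q r.
      cayley_geodesic G X a p b \<and> cayley_geodesic G X b q c \<and> cayley_geodesic G X c r a \<longrightarrow>
        path_verts G X a p \<subseteq> cayley_nbhd G X \<delta> (path_verts G X b q \<union> path_verts G X c r) \<and>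
        path_verts G X b q \<subseteq> cayley_nbhd G X \<delta> (path_verts G X c r \<union> path_verts G X a p) \<and>
        path_verts G X c r \<subseteq> cayley_nbhd G X \<delta> (path_verts G X a p \<union> path_verts G X b q))"

definition negatively_curved :: "('a, 'm) monoid_scheme \<Rightarrow> 'a set \<Rightarrow> bool" where
  "negatively_curved G X \<longleftrightarrow> (\<exists>\<delta>\<ge>0. delta_negatively_curved G X \<delta>)"

definition quasiconvex :: "('a, 'm) monoid_scheme \<Rightarrow> 'a set \<Rightarrow> 'a set \<Rightarrow> bool" where
  "quasiconvex G X H \<longleftrightarrow>
    subgroup H G \<and>
    (\<exists>\<mu>\<ge>0. \<forall>a\<in>H. \<forall>b\<in>H. \<forall>p.
      cayley_geodesic G X a p b \<longrightarrow> path_verts G X a p \<subseteq> cayley_nbhd G X \<mu> H)"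


section \<open>Finite index and residual finiteness\<close>

definition finite_index_subgroup :: "'a set \<Rightarrow> ('a, 'm) monoid_scheme \<Rightarrow> bool" where
  "finite_index_subgroup H G \<longleftrightarrow> subgroup H G \<and> finite (rcosets\<^bsub>G\<^esub> H)"

definition residually_finite :: "('a, 'm) monoid_scheme \<Rightarrow> bool" where
  "residually_finite K \<longleftrightarrow>
    (\<forall>S. finite S \<and> S \<subseteq> carrier K - {\<one>\<^bsub>K\<^esub>} \<longrightarrow>
      (\<exists>N. finite_index_subgroup N K \<and> N \<inter> S = {}))"


section \<open>Free products of two groups\<close>

text \<open>
  The free product of A and B is the quotient of the monoid of words over the disjoint union of
  the two carriers by the congruence that multiplies adjacent letters from the same factor and
  deletes identity letters.
\<close>

abbreviation free_product_words ::
    "('a, 'm) monoid_scheme \<Rightarrow> ('b, 'n) monoid_scheme \<Rightarrow> ('a + 'b) list set" where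
  "free_product_words A B \<equiv> lists (carrier A <+> carrier B)"

inductive_set free_product_cong ::
    "('a, 'm) monoid_scheme \<Rightarrow> ('b, 'n) monoid_scheme \<Rightarrow> (('a + 'b) list \<times> ('a + 'b) list) set"
  for A :: "('a, 'm) monoid_scheme" and B :: "('b, 'n) monoid_scheme" where
  refl: "w \<in> free_product_words A B \<Longrightarrow> (w, w) \<in> free_product_cong A B"
| sym: "(v, w) \<in> free_product_cong A B \<Longrightarrow> (w, v) \<in> free_product_cong A B"
| trans: "(u, v) \<in> free_product_cong A B \<Longrightarrow> (v, w) \<in> free_product_cong A B \<Longrightarrow>
    (u, w) \<in> free_product_cong A B"
| app: "(u, u') \<in> free_product_cong A B \<Longrightarrow> (v, v') \<in> free_product_cong A B \<Longrightarrow>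
    (u @ v, u' @ v') \<in> free_product_cong A B"
| one_left: "([Inl \<one>\<^bsub>A\<^esub>], []) \<in> free_product_cong A B"
| one_right: "([Inr \<one>\<^bsub>B\<^esub>], []) \<in> free_product_cong A B"
| mult_left: "a \<in> carrier A \<Longrightarrow> a' \<in> carrier A \<Longrightarrow>
    ([Inl a, Inl a'], [Inl (a \<otimes>\<^bsub>A\<^esub> a')]) \<in> free_product_cong A B"
| mult_right: "b \<in> carrier B \<Longrightarrow> b' \<in> carrier B \<Longrightarrow>
    ([Inr b, Inr b'], [Inr (b \<otimes>\<^bsub>B\<^esub> b')]) \<in> free_product_cong A B"

definition free_product ::
    "('a, 'm) monoid_scheme \<Rightarrow> ('b, 'n) monoid_scheme \<Rightarrow> ('a + 'b) list set monoid" where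
  "free_product A B =
    \<lparr> carrier = free_product_words A B // free_product_cong A B,
      mult = (\<lambda>P Q. \<Union>p\<in>P. \<Union>q\<in>Q. free_product_cong A B `` {p @ q}),
      one = free_product_cong A B `` {[]} \<rparr>"

fun word_value ::
    "('c, 'k) monoid_scheme \<Rightarrow> ('a \<Rightarrow> 'c) \<Rightarrow> ('b \<Rightarrow> 'c) \<Rightarrow> ('a + 'b) list \<Rightarrow> 'c" where
  "word_value C f g [] = \<one>\<^bsub>C\<^esub>"
| "word_value C f g (Inl a # w) = f a \<otimes>\<^bsub>C\<^esub> word_value C f g w"
| "word_value C f g (Inr b # w) = g b \<otimes>\<^bsub>C\<^esub> word_value C f g w"

text \<open>
  The homomorphism on the free product induced by two homomorphisms f and g on the factors: the
  common value of all words of a congruence class (see the lemmas below).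
\<close>

definition free_product_lift ::
    "('c, 'k) monoid_scheme \<Rightarrow> ('a \<Rightarrow> 'c) \<Rightarrow> ('b \<Rightarrow> 'c) \<Rightarrow> ('a + 'b) list set \<Rightarrow> 'c" where
  "free_product_lift C f g P = the_elem (word_value C f g ` P)"

definition generates_free_product :: "('a, 'm) monoid_scheme \<Rightarrow> 'a set \<Rightarrow> 'a set \<Rightarrow> bool" where
  "generates_free_product G A B \<longleftrightarrow>
    (let J = G\<lparr>carrier := generate G (A \<union> B)\<rparr> in
      free_product_lift J (\<lambda>a. a) (\<lambda>b. b)
        \<in> iso (free_product (G\<lparr>carrier := A\<rparr>) (G\<lparr>carrier := B\<rparr>)) J)"


subsection \<open>The free product is a group with the expected universal property\<close>

context
  fixes A :: "('a, 'm) monoid_scheme" and B :: "('b, 'n) monoid_scheme"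
  assumes grpA: "group A" and grpB: "group B"
begin

interpretation A: group A by (rule grpA)
interpretation B: group B by (rule grpB)

lemma free_product_cong_words:
  "(v, w) \<in> free_product_cong A B \<Longrightarrow> v \<in> free_product_words A B \<and> w \<in> free_product_words A B"
  by (induction rule: free_product_cong.induct) auto

lemma equiv_free_product_cong: "equiv (free_product_words A B) (free_product_cong A B)"
proof (rule equivI)
  show "free_product_cong A B \<subseteq> free_product_words A B \<times> free_product_words A B"
    by (auto dest: free_product_cong_words simp del: in_lists_conv_set)
  show "refl_on (free_product_words A B) (free_product_cong A B)"
    by (auto simp: refl_on_def intro: free_product_cong.refl)
  show "sym (free_product_cong A B)" by (rule symI) (rule free_product_cong.sym)
  show "trans (free_product_cong A B)" by (rule transI) (rule free_product_cong.trans)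
qed

lemma free_product_mult_class:
  assumes "v \<in> free_product_words A B" "w \<in> free_product_words A B"
  shows "free_product_cong A B `` {v} \<otimes>\<^bsub>free_product A B\<^esub> free_product_cong A B `` {w}
    = free_product_cong A B `` {v @ w}"
proof -
  let ?R = "free_product_cong A B"
  have eq: "?R `` {p @ q} = ?R `` {v @ w}" if "(v, p) \<in> ?R" "(w, q) \<in> ?R" for p q
    using equiv_class_eq[OF equiv_free_product_cong free_product_cong.app[OF that]] by simp
  have "v \<in> ?R `` {v}" "w \<in> ?R `` {w}"
    using assms by (auto intro: free_product_cong.refl)
  then show ?thesis
    unfolding free_product_def monoid.simps using eq by (intro equalityI subsetI; blast)
qed

lemma group_free_product: "group (free_product A B)"
proof -
  let ?R = "free_product_cong A B" and ?W = "free_product_words A B" and ?F = "free_product A B"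
  have carr: "carrier ?F = ?W // ?R" and one: "\<one>\<^bsub>?F\<^esub> = ?R `` {[]}"
    by (simp_all add: free_product_def)
  have cls: "?R `` {w} \<in> carrier ?F" if "w \<in> ?W" for w
    using that by (auto simp: carr intro: quotientI)
  have inv_word: "\<exists>v\<in>?W. (v @ w, []) \<in> ?R" if "w \<in> ?W" for w
    using that
  proof (induction w)
    case Nil
    then show ?case by (auto intro!: bexI[of _ "[]"] free_product_cong.refl)
  next
    case (Cons x w)
    then obtain v where v: "v \<in> ?W" "(v @ w, []) \<in> ?R" by auto
    have w: "w \<in> ?W" using Cons by auto
    obtain y where y: "y \<in> carrier A <+> carrier B" "([y, x], []) \<in> ?R"
    proof (cases x)
      case (Inl a)
      with Cons have a: "a \<in> carrier A" by auto
      have "([Inl (inv\<^bsub>A\<^esub> a), Inl a], [Inl \<one>\<^bsub>A\<^esub>]) \<in> ?R"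
        using free_product_cong.mult_left[of "inv\<^bsub>A\<^esub> a" A a B] a by simp
      then show ?thesis
        using that[of "Inl (inv\<^bsub>A\<^esub> a)"] a Inl
          free_product_cong.trans[OF _ free_product_cong.one_left] by auto
    next
      case (Inr b)
      with Cons have b: "b \<in> carrier B" by auto
      have "([Inr (inv\<^bsub>B\<^esub> b), Inr b], [Inr \<one>\<^bsub>B\<^esub>]) \<in> ?R"
        using free_product_cong.mult_right[of "inv\<^bsub>B\<^esub> b" B b A] b by simp
      then show ?thesis
        using that[of "Inr (inv\<^bsub>B\<^esub> b)"] b Inr
          free_product_cong.trans[OF _ free_product_cong.one_right] by auto
    qed
    have "([y, x] @ w, [] @ w) \<in> ?R"
      by (rule free_product_cong.app[OF y(2) free_product_cong.refl[OF w]])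
    then have "(v @ ([y, x] @ w), v @ ([] @ w)) \<in> ?R"
      by (rule free_product_cong.app[OF free_product_cong.refl[OF v(1)]])
    then have "((v @ [y]) @ x # w, []) \<in> ?R"
      using free_product_cong.trans[of "v @ ([y, x] @ w)" "v @ ([] @ w)" A B "[]"] v by simp
    then show ?case using v y by (intro bexI[of _ "v @ [y]"]) auto
  qed
  show ?thesis
  proof (rule groupI)
    show "\<one>\<^bsub>?F\<^esub> \<in> carrier ?F" using cls[of "[]"] by (simp add: one)
  next
    fix P Q assume "P \<in> carrier ?F" "Q \<in> carrier ?F"
    then obtain v w where vw: "v \<in> ?W" "w \<in> ?W" "P = ?R `` {v}" "Q = ?R `` {w}"
      unfolding carr by (auto elim!: quotientE)
    then show "P \<otimes>\<^bsub>?F\<^esub> Q \<in> carrier ?F"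
      using cls[of "v @ w"] free_product_mult_class[of v w] by (auto simp: append_in_lists_conv)
  next
    fix P Q S assume "P \<in> carrier ?F" "Q \<in> carrier ?F" "S \<in> carrier ?F"
    then obtain u v w where uvw: "u \<in> ?W" "v \<in> ?W" "w \<in> ?W"
      "P = ?R `` {u}" "Q = ?R `` {v}" "S = ?R `` {w}"
      unfolding carr by (auto elim!: quotientE)
    then show "P \<otimes>\<^bsub>?F\<^esub> Q \<otimes>\<^bsub>?F\<^esub> S = P \<otimes>\<^bsub>?F\<^esub> (Q \<otimes>\<^bsub>?F\<^esub> S)"
      by (simp only: free_product_mult_class append_in_lists_conv append_assoc simp_thms)
  next
    fix P assume "P \<in> carrier ?F"
    then obtain w where w: "w \<in> ?W" "P = ?R `` {w}"
      unfolding carr by (auto elim!: quotientE)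
    then show "\<one>\<^bsub>?F\<^esub> \<otimes>\<^bsub>?F\<^esub> P = P"
      using free_product_mult_class[of "[]" w] by (simp add: one)
    obtain v where v: "v \<in> ?W" "(v @ w, []) \<in> ?R" using inv_word w by blast
    have "?R `` {v} \<otimes>\<^bsub>?F\<^esub> P = \<one>\<^bsub>?F\<^esub>"
      using free_product_mult_class[OF v(1) w(1)] w(2)
        equiv_class_eq[OF equiv_free_product_cong v(2)] by (simp add: one)
    then show "\<exists>Q\<in>carrier ?F. Q \<otimes>\<^bsub>?F\<^esub> P = \<one>\<^bsub>?F\<^esub>"
      using cls[OF v(1)] by blast
  qed
qed

context
  fixes C :: "('c, 'k) monoid_scheme" and f :: "'a \<Rightarrow> 'c" and g :: "'b \<Rightarrow> 'c"
  assumes grpC: "group C" and homf: "f \<in> hom A C" and homg: "g \<in> hom B C"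
begin

interpretation C: group C by (rule grpC)
interpretation f: group_hom A C f by unfold_locales (rule homf)
interpretation g: group_hom B C g by unfold_locales (rule homg)

lemma word_value_closed: "w \<in> free_product_words A B \<Longrightarrow> word_value C f g w \<in> carrier C"
proof (induction w)
  case (Cons x w)
  then show ?case by (cases x) auto
qed auto

lemma word_value_append:
  "v \<in> free_product_words A B \<Longrightarrow> w \<in> free_product_words A B \<Longrightarrow>
    word_value C f g (v @ w) = word_value C f g v \<otimes>\<^bsub>C\<^esub> word_value C f g w"
proof (induction v)
  case (Cons x v)
  then have "word_value C f g v \<in> carrier C" "word_value C f g w \<in> carrier C"
    by (auto intro!: word_value_closed simp del: in_lists_conv_set)
  with Cons show ?case by (cases x) (auto simp: C.m_assoc)
qed (simp add: word_value_closed del: in_lists_conv_set)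

lemma word_value_cong:
  "(v, w) \<in> free_product_cong A B \<Longrightarrow> word_value C f g v = word_value C f g w"
proof (induction rule: free_product_cong.induct)
  case (app u u' v v')
  then show ?case using free_product_cong_words by (simp add: word_value_append)
qed (auto simp: C.m_assoc)

lemma free_product_lift_class:
  assumes "w \<in> free_product_words A B"
  shows "free_product_lift C f g (free_product_cong A B `` {w}) = word_value C f g w"
proof -
  have "word_value C f g ` (free_product_cong A B `` {w}) = {word_value C f g w}"
    using free_product_cong.refl[OF assms] by (auto simp: image_iff dest: word_value_cong)
  then show ?thesis by (simp add: free_product_lift_def)
qed

lemma free_product_lift_left:
  "a \<in> carrier A \<Longrightarrow> free_product_lift C f g (free_product_cong A B `` {[Inl a]}) = f a"
  by (subst free_product_lift_class) auto

lemma free_product_lift_right: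
  "b \<in> carrier B \<Longrightarrow> free_product_lift C f g (free_product_cong A B `` {[Inr b]}) = g b"
  by (subst free_product_lift_class) auto

lemma free_product_lift_hom: "free_product_lift C f g \<in> hom (free_product A B) C"
proof (rule homI)
  fix P assume "P \<in> carrier (free_product A B)"
  then obtain w where "w \<in> free_product_words A B" "P = free_product_cong A B `` {w}"
    by (auto simp: free_product_def elim!: quotientE)
  then show "free_product_lift C f g P \<in> carrier C"
    by (simp only: free_product_lift_class word_value_closed)
next
  fix P Q assume "P \<in> carrier (free_product A B)" "Q \<in> carrier (free_product A B)"
  then obtain v w where vw: "v \<in> free_product_words A B" "w \<in> free_product_words A B"
      "P = free_product_cong A B `` {v}" "Q = free_product_cong A B `` {w}"
    by (auto simp: free_product_def elim!: quotientE)
  then show "free_product_lift C f g (P \<otimes>\<^bsub>free_product A B\<^esub> Q)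
      = free_product_lift C f g P \<otimes>\<^bsub>C\<^esub> free_product_lift C f g Q"
    by (simp only: free_product_mult_class free_product_lift_class word_value_append
        append_in_lists_conv simp_thms)
qed

lemma free_product_lift_unique:
  assumes h: "h \<in> hom (free_product A B) C"
    and hl: "\<And>a. a \<in> carrier A \<Longrightarrow> h (free_product_cong A B `` {[Inl a]}) = f a"
    and hr: "\<And>b. b \<in> carrier B \<Longrightarrow> h (free_product_cong A B `` {[Inr b]}) = g b"
    and P: "P \<in> carrier (free_product A B)"
  shows "h P = free_product_lift C f g P"
proof -
  let ?R = "free_product_cong A B" and ?W = "free_product_words A B" and ?F = "free_product A B"
  interpret h: group_hom ?F C h
    using h by (intro group_hom.intro group_free_product grpC group_hom_axioms.intro)
  have cls: "?R `` {w} \<in> carrier ?F" if "w \<in> ?W" for w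
    using that by (auto simp: free_product_def intro: quotientI)
  have "h (?R `` {w}) = word_value C f g w" if "w \<in> ?W" for w
    using that
  proof (induction w)
    case Nil
    then show ?case using h.hom_one by (simp add: free_product_def)
  next
    case (Cons x w)
    then have x: "[x] \<in> ?W" and w: "w \<in> ?W" by auto
    have "?R `` {x # w} = ?R `` {[x]} \<otimes>\<^bsub>?F\<^esub> ?R `` {w}"
      using free_product_mult_class[OF x w] by simp
    then have "h (?R `` {x # w}) = h (?R `` {[x]}) \<otimes>\<^bsub>C\<^esub> word_value C f g w"
      using h.hom_mult[OF cls[OF x] cls[OF w]] Cons.IH by simp
    then show ?case using x by (cases x) (auto simp: hl hr)
  qed
  moreover obtain w where "w \<in> ?W" "P = ?R `` {w}"
    using P by (auto simp: free_product_def elim!: quotientE)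
  ultimately show ?thesis by (simp only: free_product_lift_class)
qed

end

end

end

theory Submission
  imports Defs
begin

text \<open>
  Geodesics issuing from the identity to points of H and of K fellow-travel only for a bounded time:
  otherwise infinitely many points of H would lie at bounded distance from K, and by the pigeonhole
  principle on a ball two of them would give a common nontrivial element of H and K. So the Gromov
  products of elements of H with elements of K are bounded by a constant C. If all nontrivial
  elements of finite index subgroups A of H and B of K are long compared with C, then every reduced
  word in A and B traces a broken path with long edges and small Gromov products at its corners. In
  a hyperbolic space such a path leaves its starting point, whence the free product, and the
  geodesic joining its ends stays close to it, whence quasiconvexity. Residual finiteness removes
  the finitely many short elements.
\<close>

section \<open>Broken paths in hyperbolic spaces\<close>

text \<open>Thin triangles are converted once into the four-point inequality; from then on the
  estimates along broken paths use only distances, and geodesic walks return only through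
  quasiconvexity. What drives these estimates is that, seen from a fixed point, the Gromov products
  at the two ends of an edge add up to its length. A long edge with a small product at one end has a
  large one at the other, so this large product cannot be the minimum in the hyperbolic inequality
  and the other term must be small. Forward and backward bounds are \<open>C + \<Delta>\<close>;
  joining them at a middle vertex needs \<open>L - (C + \<Delta>) > C + 2 * \<Delta>\<close>, which
  is the condition on \<open>L\<close>.

  The order of choices matters. \<open>C\<close> depends on H and K alone and passes to all their
  subgroups, so \<open>L\<close> and the finite set of short elements are fixed before any subgroup
  is chosen. The two sequences can therefore be built independently, and every member of one fits
  every member of the other. The quasiconvexity constant of the join may vary with the pair.\<close>

locale hyperbolic_space =
  fixes M :: "'p set" and d :: "'p \<Rightarrow> 'p \<Rightarrow> real" and \<Delta> :: real
  assumes dist_refl: "x \<in> M \<Longrightarrow> d x x = 0"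
    and dist_nonneg: "x \<in> M \<Longrightarrow> y \<in> M \<Longrightarrow> 0 \<le> d x y"
    and dist_commute: "x \<in> M \<Longrightarrow> y \<in> M \<Longrightarrow> d x y = d y x"
    and dist_triangle: "x \<in> M \<Longrightarrow> y \<in> M \<Longrightarrow> z \<in> M \<Longrightarrow> d x z \<le> d x y + d y z"
    and four_point: "x \<in> M \<Longrightarrow> y \<in> M \<Longrightarrow> z \<in> M \<Longrightarrow> w \<in> M \<Longrightarrow>
      d x y + d z w \<le> max (d x z + d y w) (d x w + d y z) + 2 * \<Delta>"
    and delta_nonneg: "0 \<le> \<Delta>"
begin

definition gromov :: "'p \<Rightarrow> 'p \<Rightarrow> 'p \<Rightarrow> real" where
  "gromov x y w = (d x w + d y w - d x y) / 2"

lemma gromov_commute: "x \<in> M \<Longrightarrow> y \<in> M \<Longrightarrow> gromov x y w = gromov y x w"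
  by (simp add: gromov_def dist_commute)

lemma gromov_nonneg: "x \<in> M \<Longrightarrow> y \<in> M \<Longrightarrow> w \<in> M \<Longrightarrow> 0 \<le> gromov x y w"
  using dist_triangle[of x w y] by (simp add: gromov_def dist_commute)

lemma gromov_hyp:
  assumes "x \<in> M" "y \<in> M" "z \<in> M" "w \<in> M"
  shows "min (gromov x y w) (gromov y z w) - \<Delta> \<le> gromov x z w"
  using four_point[of x z y w] assms dist_commute[of y z]
  by (auto simp: gromov_def max_def min_def field_simps split: if_splits)

text \<open>In the tripod comparing x, y and z, the legs at y and z fill the side between them. On a
  long edge this turns a small product at one end into a large one at the other.\<close>

lemma gromov_shift:
  assumes "x \<in> M" "y \<in> M" "z \<in> M"
  shows "gromov x y z = d y z - gromov x z y"
  using assms dist_commute[of y z] by (simp add: gromov_def field_simps)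

section \<open>From corner conditions to global estimates\<close>

definition broken_path :: "(nat \<Rightarrow> 'p) \<Rightarrow> nat \<Rightarrow> real \<Rightarrow> real \<Rightarrow> bool" where
  "broken_path x n C L \<longleftrightarrow> (\<forall>i\<le>n. x i \<in> M) \<and>
    (\<forall>i<n. L \<le> d (x i) (x (Suc i))) \<and>
    (\<forall>i. Suc i < n \<longrightarrow> gromov (x i) (x (Suc (Suc i))) (x (Suc i)) \<le> C)"

lemma broken_path_rev:
  assumes "broken_path x n C L"
  shows "broken_path (\<lambda>i. x (n - i)) n C L"
  unfolding broken_path_def
proof (intro conjI allI impI)
  fix i assume "i < n"
  then have "n - i = Suc (n - Suc i)" "n - Suc i < n" by auto
  then show "L \<le> d (x (n - i)) (x (n - Suc i))"
    using assms by (metis broken_path_def dist_commute less_imp_le_nat Suc_leI)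
next
  fix i assume "Suc i < n"
  then have "n - i = Suc (Suc (n - Suc (Suc i)))" "n - Suc i = Suc (n - Suc (Suc i))"
      "Suc (n - Suc (Suc i)) < n" by auto
  then show "gromov (x (n - i)) (x (n - Suc (Suc i))) (x (n - Suc i)) \<le> C"
    using assms gromov_commute[of "x (n - i)" "x (n - Suc (Suc i))"]
    by (auto simp: broken_path_def)
qed (use assms in \<open>auto simp: broken_path_def\<close>)

context
  fixes C L :: real
  assumes C: "0 \<le> C" and L: "2 * C + 3 * \<Delta> < L"
begin

text \<open>The corner condition sees only the two neighbours of a vertex; here one of them is
  replaced by any earlier vertex. The loss of \<open>\<Delta>\<close> does not accumulate, because
  every induction step starts again from the corner bound \<open>C\<close>.\<close>

lemma broken_path_forward:
  assumes "broken_path x n C L" "i \<le> j" "j < n"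
  shows "gromov (x i) (x (Suc j)) (x j) \<le> C + \<Delta>"
  using assms(2,3)
proof (induction j rule: dec_induct)
  case base
  then show ?case
    using assms(1) C delta_nonneg by (simp add: broken_path_def gromov_def dist_refl dist_commute)
next
  case (step j)
  have M: "x i \<in> M" "x j \<in> M" "x (Suc j) \<in> M" "x (Suc (Suc j)) \<in> M"
    using assms(1) step by (auto simp: broken_path_def)
  have "gromov (x i) (x (Suc j)) (x j) \<le> C + \<Delta>" "L \<le> d (x j) (x (Suc j))"
    using step assms(1) by (auto simp: broken_path_def)
  \<comment> \<open>By \<open>gromov_shift\<close> this product is at least
    \<open>L - (C + \<Delta>)\<close>. It is too large to be the minimum in
    \<open>gromov_hyp\<close>, whose left side must stay below \<open>C\<close>.\<close>
  then have "C + \<Delta> < gromov (x i) (x j) (x (Suc j))"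
    using gromov_shift[of "x i" "x j" "x (Suc j)"] M L delta_nonneg by simp
  moreover have "gromov (x j) (x (Suc (Suc j))) (x (Suc j)) \<le> C"
    using step assms(1) by (auto simp: broken_path_def)
  ultimately show ?case
    using gromov_hyp[of "x j" "x i" "x (Suc (Suc j))" "x (Suc j)"] M gromov_commute[of "x i" "x j"]
    by (auto simp: min_def split: if_splits)
qed

text \<open>This is the forward bound on the reversed path, where \<open>x i\<close> has index
  \<open>n - i\<close> and is followed by \<open>x (i - 1)\<close>.\<close>

lemma broken_path_backward:
  assumes "broken_path x n C L" "0 < i" "i \<le> j" "j \<le> n"
  shows "gromov (x (i - 1)) (x j) (x i) \<le> C + \<Delta>"
proof -
  have "gromov (x (n - (n - j))) (x (n - Suc (n - i))) (x (n - (n - i))) \<le> C + \<Delta>"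
    using assms by (intro broken_path_forward[OF broken_path_rev[OF assms(1)]]) auto
  moreover have "n - (n - j) = j" "n - Suc (n - i) = i - 1" "n - (n - i) = i"
    using assms by auto
  moreover have "x j \<in> M" "x (i - 1) \<in> M" using assms by (auto simp: broken_path_def)
  ultimately show ?thesis using gromov_commute by simp
qed

lemma broken_path_grows:
  assumes "broken_path x n C L" "0 < n"
  shows "0 < d (x 0) (x n)"
proof -
  have gt: "d (x 0) (x j) < d (x 0) (x (Suc j))" if "j < n" for j
  proof -
    have "gromov (x 0) (x (Suc j)) (x j) \<le> C + \<Delta>" "L \<le> d (x j) (x (Suc j))"
        "x j \<in> M" "x (Suc j) \<in> M" "x 0 \<in> M"
      using that assms broken_path_forward by (auto simp: broken_path_def)
    \<comment> \<open>The new edge adds its length minus twice this product, hence at least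
      \<open>L - 2 * (C + \<Delta>) > 0\<close>.\<close>
    then show ?thesis using L delta_nonneg dist_commute[of "x j" "x (Suc j)"] by (simp add: gromov_def)
  qed
  obtain k where "n = Suc k" using assms(2) by (cases n) auto
  moreover have "0 \<le> d (x 0) (x k)" using assms \<open>n = Suc k\<close>
    by (intro dist_nonneg) (auto simp: broken_path_def)
  ultimately show ?thesis using gt[of k] by simp
qed

text \<open>The predecessor \<open>x k\<close> links the two sides: its product with the start is
  large by the forward bound, its product with the end is small by the backward bound. The full
  margin \<open>3 * \<Delta>\<close> in \<open>L\<close> is spent here.\<close>

lemma broken_path_middle:
  assumes "broken_path x n C L" "j \<le> n"
  shows "gromov (x 0) (x n) (x j) \<le> C + 2 * \<Delta>"
proof (cases j)
  case 0
  then show ?thesis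
    using assms C delta_nonneg by (simp add: broken_path_def gromov_def dist_refl dist_commute)
next
  case (Suc k)
  have M: "x 0 \<in> M" "x k \<in> M" "x j \<in> M" "x n \<in> M"
    using assms Suc by (auto simp: broken_path_def)
  have "gromov (x 0) (x j) (x k) \<le> C + \<Delta>" "L \<le> d (x k) (x j)"
    using assms Suc broken_path_forward[of x n 0 k] by (auto simp: broken_path_def)
  then have "C + 2 * \<Delta> < gromov (x 0) (x k) (x j)"
    using gromov_shift[of "x 0" "x k" "x j"] M L by simp
  moreover have "gromov (x k) (x n) (x j) \<le> C + \<Delta>"
    using broken_path_backward[OF assms(1), of j n] Suc assms(2) by simp
  ultimately show ?thesis
    using gromov_hyp[of "x k" "x 0" "x n" "x j"] M gromov_commute[of "x 0" "x k"]
    by (auto simp: min_def split: if_splits)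
qed

text \<open>For the first vertex whose Gromov product with the start, seen from p, is small, the
  path passes p on the preceding edge.\<close>

lemma broken_path_shadows_geodesic:
  assumes bp: "broken_path x n C L" and "0 < n" and p: "p \<in> M"
    and between: "d (x 0) p + d p (x n) = d (x 0) (x n)"
  shows "\<exists>i<n. gromov (x i) (x (Suc i)) p \<le> 2 * C + 6 * \<Delta>"
proof -
  have M: "x i \<in> M" if "i \<le> n" for i using bp that by (auto simp: broken_path_def)
  have zero: "gromov (x 0) (x n) p = 0"
    using between dist_commute[OF p M] by (simp add: gromov_def)
  define k where "k = (LEAST i. gromov (x 0) (x i) p \<le> \<Delta>)"
  have k: "gromov (x 0) (x k) p \<le> \<Delta>" "k \<le> n"
    using zero delta_nonneg unfolding k_def
    by (auto intro: LeastI2[of _ n] Least_le[of _ n])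
  show ?thesis
  proof (cases k)
    case 0
    then have "d (x 0) p \<le> \<Delta>"
      using k M by (simp add: gromov_def dist_refl)
    moreover have "gromov (x 0) (x 1) p \<le> d (x 0) p"
      using dist_triangle[of "x 1" "x 0" p] M[of 0] M[of 1] p dist_commute[of "x 0" "x 1"] \<open>0 < n\<close>
      by (simp add: gromov_def)
    ultimately show ?thesis using \<open>0 < n\<close> C delta_nonneg by (intro exI[of _ 0]) auto
  next
    case (Suc i)
    then have "\<Delta> < gromov (x 0) (x i) p"
      using not_less_Least[of i "\<lambda>i. gromov (x 0) (x i) p \<le> \<Delta>"] unfolding k_def by auto
    then have ineq: "gromov (x i) (x n) p \<le> \<Delta>"
      using gromov_hyp[of "x 0" "x i" "x n" p] zero M p Suc k by (auto simp: min_def split: if_splits)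
    have "gromov (x 0) (x n) (x k) \<le> C + 2 * \<Delta>" "gromov (x 0) (x k) (x i) \<le> C + \<Delta>"
      using broken_path_middle[OF bp] broken_path_forward[OF bp, of 0 i] k Suc by auto
    moreover have "d (x i) (x n) \<le> d (x i) (x k) + d (x k) (x n)"
      using M k Suc by (intro dist_triangle) auto
    moreover have "d (x k) (x i) = d (x i) (x k)" "d (x n) (x k) = d (x k) (x n)"
      using M k Suc by (auto intro: dist_commute)
    \<comment> \<open>Two near-betweenness relations are added: p lies almost between
      \<open>x 0\<close> and \<open>x k\<close>, and almost between \<open>x i\<close> and
      \<open>x n\<close>, each up to \<open>2 * \<Delta>\<close>. After \<open>x k\<close> is
      inserted between \<open>x i\<close> and \<open>x n\<close>, what remains is the product of the
      two ends at \<open>x k\<close>; the total \<open>C + 4 * \<Delta>\<close> is within the stated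
      bound.\<close>
    ultimately have "gromov (x i) (x k) p \<le> 2 * C + 6 * \<Delta>"
      using ineq zero k C delta_nonneg by (simp add: gromov_def field_simps)
    then show ?thesis using Suc k by (auto simp: Suc_le_eq)
  qed
qed

end

text \<open>Turns a small product into closeness to an actual point q of a geodesic. The point q is
  as far from u as p is, or at distance 0 from v if p is farther away than v. In the four-point
  inequality one alternative leaves only \<open>2 * \<Delta>\<close>, the other adds the defect
  \<open>2 * gromov u v p\<close>.\<close>

lemma dist_le_gromov:
  assumes M: "u \<in> M" "v \<in> M" "p \<in> M" "q \<in> M"
    and q: "d u q + d q v = d u v" "d u q = min (d u p) (d u v)"
  shows "d p q \<le> 2 * gromov u v p + 2 * \<Delta>"
proof (cases "d u p \<le> d u v")
  case True
  then show ?thesis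
    using four_point[of p q u v] q dist_commute[of p u] dist_commute[of p v] M
      dist_commute[of q u] dist_commute[of q v] gromov_nonneg[of u v p] delta_nonneg
    by (auto simp: gromov_def max_def field_simps split: if_splits)
next
  case False
  then have "d q v = 0" using q by simp
  then have "d p q \<le> d p v" using dist_triangle[of p v q] M dist_commute[of q v] by simp
  moreover have "2 * gromov u v p = d u p + d v p - d u v" by (simp add: gromov_def)
  moreover have "d v p = d p v" using M dist_commute by blast
  ultimately show ?thesis using False delta_nonneg by linarith
qed

end

section \<open>The word metric\<close>

locale cayley = group G for G :: "('a, 'm) monoid_scheme" (structure) +
  fixes X :: "'a set"
  assumes finite_X: "finite X" and X_carrier: "X \<subseteq> carrier G"
    and generate_X: "generate G X = carrier G"
begin

abbreviation "\<Gamma> \<equiv> cayley_graph G X"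

text \<open>Relation powers replace walks, so that reversal, concatenation and left translation need
  no lists of arcs.\<close>

definition step :: "('a \<times> 'a) set" where
  "step = {(g, g \<otimes> x) | g x. g \<in> carrier G \<and> x \<in> symmetrized G X}"

lemma symmetrized_carrier: "symmetrized G X \<subseteq> carrier G"
  using X_carrier by (auto simp: symmetrized_def)

sublocale wf_digraph \<Gamma>
  using symmetrized_carrier by unfold_locales (auto simp: cayley_graph_def)

lemma step_carrier: "(a, b) \<in> step \<Longrightarrow> a \<in> carrier G \<and> b \<in> carrier G"
  using symmetrized_carrier by (auto simp: step_def)

lemma awalk_relpow:
  "(\<exists>p. awalk a p b \<and> length p = n) \<longleftrightarrow> a \<in> carrier G \<and> (a, b) \<in> step ^^ n"
proof (induction n arbitrary: a)
  case 0
  have "verts \<Gamma> = carrier G" by (simp add: cayley_graph_def)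
  then show ?case by (auto simp: awalk_Nil_iff)
next
  case (Suc n)
  have "(\<exists>p. awalk a p b \<and> length p = Suc n) \<longleftrightarrow>
      (\<exists>e p. e \<in> arcs \<Gamma> \<and> tail \<Gamma> e = a \<and> awalk (head \<Gamma> e) p b \<and> length p = n)"
    by (simp add: length_Suc_conv) (metis awalk_Cons_iff)
  also have "\<dots> \<longleftrightarrow> (\<exists>e. e \<in> arcs \<Gamma> \<and> tail \<Gamma> e = a \<and> head \<Gamma> e \<in> carrier G \<and> (head \<Gamma> e, b) \<in> step ^^ n)"
    using Suc.IH by blast
  also have "\<dots> \<longleftrightarrow> a \<in> carrier G \<and> (\<exists>c. (a, c) \<in> step \<and> (c, b) \<in> step ^^ n)"
    using symmetrized_carrier by (auto simp: cayley_graph_def step_def)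
  also have "\<dots> \<longleftrightarrow> a \<in> carrier G \<and> (a, b) \<in> step ^^ Suc n"
    by (metis relpow_Suc_D2 relpow_Suc_I2)
  finally show ?case .
qed

abbreviation cdist :: "'a \<Rightarrow> 'a \<Rightarrow> nat" where
  "cdist \<equiv> cayley_dist G X"

lemma cdist_le: "a \<in> carrier G \<Longrightarrow> (a, b) \<in> step ^^ n \<Longrightarrow> cdist a b \<le> n"
  unfolding cayley_dist_def awalk_relpow by (simp add: Least_le)

lemma step_sym: "(a, b) \<in> step \<Longrightarrow> (b, a) \<in> step"
proof -
  assume "(a, b) \<in> step"
  then obtain x where x: "a \<in> carrier G" "x \<in> symmetrized G X" "b = a \<otimes> x"
    by (auto simp: step_def)
  moreover have "inv x \<in> symmetrized G X"
    using x X_carrier by (auto simp: symmetrized_def)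
  ultimately show ?thesis
    using symmetrized_carrier unfolding step_def
    by (auto intro!: exI[of _ "inv x"] simp: m_assoc subset_iff)
qed

lemma relpow_step_sym: "(a, b) \<in> step ^^ n \<Longrightarrow> (b, a) \<in> step ^^ n"
  by (induction n arbitrary: b) (auto simp del: relpow.simps(2) elim!: relpow_Suc_E intro: relpow_Suc_I2 step_sym)

lemma relpow_step_trans: "(a, b) \<in> step ^^ m \<Longrightarrow> (b, c) \<in> step ^^ n \<Longrightarrow> (a, c) \<in> step ^^ (m + n)"
  by (auto simp: relpow_add)

lemma step_mult: "g \<in> carrier G \<Longrightarrow> (a, b) \<in> step \<Longrightarrow> (g \<otimes> a, g \<otimes> b) \<in> step"
  using symmetrized_carrier by (force simp: step_def m_assoc)

lemma relpow_step_mult: "g \<in> carrier G \<Longrightarrow> (a, b) \<in> step ^^ n \<Longrightarrow> (g \<otimes> a, g \<otimes> b) \<in> step ^^ n"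
  by (induction n arbitrary: b) (auto intro: step_mult)

lemma connected_one: "a \<in> carrier G \<Longrightarrow> \<exists>n. (\<one>, a) \<in> step ^^ n"
  unfolding generate_X[symmetric]
proof (induction rule: generate.induct)
  case one
  then show ?case by (auto intro: exI[of _ 0])
next
  case (incl h)
  then have "(\<one>, h) \<in> step ^^ 1"
    using X_carrier by (auto simp: step_def symmetrized_def intro!: exI[of _ \<one>] exI[of _ h])
  then show ?case by blast
next
  case (inv h)
  then have "(\<one>, inv h) \<in> step ^^ 1"
    using X_carrier by (auto simp: step_def symmetrized_def intro!: exI[of _ \<one>] exI[of _ "inv h"])
  then show ?case by blast
next
  case (eng h k)
  then obtain m n where mn: "(\<one>, h) \<in> step ^^ m" "(\<one>, k) \<in> step ^^ n" by blast
  have "h \<in> carrier G" using eng generate_X by simp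
  then have "(h, h \<otimes> k) \<in> step ^^ n"
    using relpow_step_mult[OF _ mn(2), of h] by simp
  then show ?case using mn(1) relpow_step_trans by blast
qed

text \<open>Because X generates G, some walk joins the two points, so the minimum in
  \<open>cayley_dist\<close> is attained and not an arbitrary value of \<open>LEAST\<close>.\<close>

lemma cdist_relpow:
  assumes "a \<in> carrier G" "b \<in> carrier G"
  shows "(a, b) \<in> step ^^ cdist a b"
proof -
  obtain n where "(\<one>, inv a \<otimes> b) \<in> step ^^ n"
    using connected_one[of "inv a \<otimes> b"] assms by auto
  then have "(a, b) \<in> step ^^ n"
    using relpow_step_mult[of a \<one> "inv a \<otimes> b" n] assms by (simp add: m_assoc[symmetric])
  then show ?thesis
    unfolding cayley_dist_def awalk_relpow using assms by (metis (mono_tags, lifting) LeastI)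
qed

lemma cdist_self: "a \<in> carrier G \<Longrightarrow> cdist a a = 0"
  using cdist_le[of a a 0] by simp

lemma cdist_commute: "a \<in> carrier G \<Longrightarrow> b \<in> carrier G \<Longrightarrow> cdist a b = cdist b a"
  using cdist_le cdist_relpow relpow_step_sym by (metis antisym)

lemma cdist_triangle:
  "a \<in> carrier G \<Longrightarrow> b \<in> carrier G \<Longrightarrow> c \<in> carrier G \<Longrightarrow> cdist a c \<le> cdist a b + cdist b c"
  by (meson cdist_le cdist_relpow relpow_step_trans)

lemma cdist_mult:
  assumes "g \<in> carrier G" "a \<in> carrier G" "b \<in> carrier G"
  shows "cdist (g \<otimes> a) (g \<otimes> b) = cdist a b"
proof (rule antisym)
  show "cdist (g \<otimes> a) (g \<otimes> b) \<le> cdist a b"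
    using assms by (intro cdist_le relpow_step_mult cdist_relpow) auto
  have "(inv g \<otimes> (g \<otimes> a), inv g \<otimes> (g \<otimes> b)) \<in> step ^^ cdist (g \<otimes> a) (g \<otimes> b)"
    using assms by (intro relpow_step_mult cdist_relpow) auto
  then show "cdist a b \<le> cdist (g \<otimes> a) (g \<otimes> b)"
    using assms by (simp add: m_assoc[symmetric] cdist_le)
qed

lemma cdist_one:
  assumes "a \<in> carrier G" "b \<in> carrier G"
  shows "cdist a b = cdist \<one> (inv a \<otimes> b)"
  using cdist_mult[of "inv a" a b] assms by simp

lemma finite_ball: "finite {g \<in> carrier G. cdist \<one> g \<le> n}"
proof -
  have "finite (step `` {a})" for a
  proof -
    have "step `` {a} \<subseteq> (\<lambda>x. a \<otimes> x) ` symmetrized G X" by (auto simp: step_def)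
    then show ?thesis by (rule finite_subset) (simp add: symmetrized_def finite_X)
  qed
  then have fin: "finite (step `` A)" if "finite A" for A
    using that by (subst Image_eq_UN) blast
  have "finite ((step ^^ n) `` {\<one>})" for n
    by (induction n) (auto simp: relcomp_Image fin)
  then have "finite (\<Union>k\<le>n. (step ^^ k) `` {\<one>})" by blast
  moreover have "{g \<in> carrier G. cdist \<one> g \<le> n} \<subseteq> (\<Union>k\<le>n. (step ^^ k) `` {\<one>})"
    by (auto intro: cdist_relpow)
  ultimately show ?thesis by (rule rev_finite_subset)
qed

section \<open>Geodesic walks in metric terms\<close>

lemma awalk_carrier: "awalk a p b \<Longrightarrow> a \<in> carrier G \<and> b \<in> carrier G"
  using awalk_hd_in_verts[of a p b] awalk_last_in_verts[of a p b] by (simp add: cayley_graph_def)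

lemma awalk_cdist_le: "awalk a p b \<Longrightarrow> cdist a b \<le> length p"
  using awalk_relpow[of a b "length p"] by (auto intro: cdist_le)

lemma geodesic_exists:
  assumes "a \<in> carrier G" "b \<in> carrier G"
  obtains p where "cayley_geodesic G X a p b"
proof -
  obtain p where "awalk a p b" "length p = cdist a b"
    using awalk_relpow cdist_relpow assms by metis
  then have "cayley_geodesic G X a p b" using awalk_cdist_le by (simp add: cayley_geodesic_def)
  then show ?thesis by (rule that)
qed

lemma geodesic_length: "cayley_geodesic G X a p b \<Longrightarrow> length p = cdist a b"
proof -
  assume p: "cayley_geodesic G X a p b"
  then have ab: "a \<in> carrier G" "b \<in> carrier G" using awalk_carrier by (auto simp: cayley_geodesic_def)
  obtain q where "awalk a q b" "length q = cdist a b"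
    using awalk_relpow cdist_relpow ab by metis
  then show ?thesis using p awalk_cdist_le[of a p b] by (auto simp: cayley_geodesic_def intro: antisym)
qed

lemma geodesic_between:
  assumes "cayley_geodesic G X a p b" "v \<in> path_verts G X a p"
  shows "v \<in> carrier G" "cdist a v + cdist v b = cdist a b"
proof -
  have p: "awalk a p b" using assms by (simp add: cayley_geodesic_def)
  obtain q r where qr: "p = q @ r" "awalk a q v" "awalk v r b"
    using awalk_decomp[OF p] assms(2) unfolding path_verts_def by blast
  show v: "v \<in> carrier G" using qr awalk_carrier by blast
  have "cdist a v + cdist v b \<le> cdist a b"
    using qr awalk_cdist_le geodesic_length[OF assms(1)] by (metis add_mono length_append)
  then show "cdist a v + cdist v b = cdist a b"
    using cdist_triangle[of a v b] v p awalk_carrier by fastforce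
qed

text \<open>A prefix with t arcs ends at distance exactly t: neither piece of the walk is shorter
  than the distance it covers, and the two distances add up to the total length. The unit steps
  serve as discrete continuity.\<close>

lemma geodesic_param:
  assumes "cayley_geodesic G X a p b"
  obtains f where "\<And>t. t \<le> cdist a b \<Longrightarrow> f t \<in> path_verts G X a p"
    and "\<And>t. t \<le> cdist a b \<Longrightarrow> cdist a (f t) = t"
    and "\<And>t. t < cdist a b \<Longrightarrow> cdist (f t) (f (Suc t)) \<le> 1"
proof
  have p: "awalk a p b" using assms by (simp add: cayley_geodesic_def)
  have len: "length p = cdist a b" using geodesic_length assms by blast
  define f where "f t = awlast a (take t p)" for t
  have w: "awalk a (take t p) (f t)" "awalk (f t) (drop t p) b" for t
    using p awalk_append_iff[of a "take t p" "drop t p" b] by (auto simp: f_def)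
  show on: "f t \<in> path_verts G X a p" if "t \<le> cdist a b" for t
    using w[of t] awalk_verts_append[of a "take t p" "drop t p" b] p
    by (simp add: path_verts_def f_def)
  show "cdist a (f t) = t" if "t \<le> cdist a b" for t
    using awalk_cdist_le[OF w(1)[of t]] awalk_cdist_le[OF w(2)[of t]] len that
      geodesic_between(2)[OF assms on[OF that]] by auto
  show "cdist (f t) (f (Suc t)) \<le> 1" if "t < cdist a b" for t
  proof -
    have "take (Suc t) p = take t p @ [p ! t]" using that len by (simp add: take_Suc_conv_app_nth)
    then have "awalk (f t) [p ! t] (f (Suc t))"
      using w(1)[of "Suc t"] awalk_append_iff[of a "take t p" "[p ! t]" "f (Suc t)"]
      by (simp add: f_def)
    from awalk_cdist_le[OF this] show ?thesis by simp
  qed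
qed

abbreviation rdist :: "'a \<Rightarrow> 'a \<Rightarrow> real" where
  "rdist a b \<equiv> real (cdist a b)"

lemma rdist_triangle:
  "a \<in> carrier G \<Longrightarrow> b \<in> carrier G \<Longrightarrow> c \<in> carrier G \<Longrightarrow> rdist a c \<le> rdist a b + rdist b c"
  using cdist_triangle[of a b c] by linarith

section \<open>Quasiconvexity and points close to two subgroups\<close>

lemma quasiconvex_geodesic:
  assumes "quasiconvex G X H"
  obtains \<mu> where "0 \<le> \<mu>"
    and "\<And>a b t. a \<in> H \<Longrightarrow> b \<in> H \<Longrightarrow> t \<le> cdist a b \<Longrightarrow>
      \<exists>v\<in>carrier G. cdist a v = t \<and> cdist a v + cdist v b = cdist a b \<and> (\<exists>h\<in>H. rdist v h \<le> \<mu>)"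
proof -
  obtain \<mu> where mu: "0 \<le> \<mu>" and nbhd: "\<And>a b p. a \<in> H \<Longrightarrow> b \<in> H \<Longrightarrow> cayley_geodesic G X a p b \<Longrightarrow>
      path_verts G X a p \<subseteq> cayley_nbhd G X \<mu> H"
    and sub: "subgroup H G"
    using assms unfolding quasiconvex_def by blast
  show ?thesis
  proof (rule that[OF mu])
    fix a b t assume ab: "a \<in> H" "b \<in> H" and t: "t \<le> cdist a b"
    obtain p where p: "cayley_geodesic G X a p b"
      using geodesic_exists ab subgroup.mem_carrier[OF sub] by metis
    obtain f where "f t \<in> path_verts G X a p" "cdist a (f t) = t"
      using geodesic_param[OF p] t by metis
    moreover have "f t \<in> cayley_nbhd G X \<mu> H" using nbhd[OF ab p] calculation by blast
    ultimately show "\<exists>v\<in>carrier G. cdist a v = t \<and> cdist a v + cdist v b = cdist a b \<and>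
        (\<exists>h\<in>H. rdist v h \<le> \<mu>)"
      using geodesic_between[OF p] unfolding cayley_nbhd_def by blast
  qed
qed

text \<open>Being on a geodesic walk is replaced by metric betweenness, the form in which the broken
  path estimates apply.\<close>

lemma quasiconvexI:
  assumes "subgroup H G" "0 \<le> \<mu>"
    and "\<And>a b v. a \<in> H \<Longrightarrow> b \<in> H \<Longrightarrow> v \<in> carrier G \<Longrightarrow>
      cdist a v + cdist v b = cdist a b \<Longrightarrow> \<exists>h\<in>H. rdist v h \<le> \<mu>"
  shows "quasiconvex G X H"
  unfolding quasiconvex_def
proof (intro conjI exI[of _ \<mu>] ballI allI impI subsetI)
  fix a b p v assume "a \<in> H" "b \<in> H" "cayley_geodesic G X a p b" "v \<in> path_verts G X a p"
  then show "v \<in> cayley_nbhd G X \<mu> H"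
    using assms(3) geodesic_between by (simp add: cayley_nbhd_def)
qed (use assms in auto)

text \<open>With finitely many coset representatives, every h in H is \<open>a \<otimes> r\<close>
  with r among them, and left invariance makes its distance to a the word length of r. Hence H stays
  within a bounded distance of A.\<close>

lemma quasiconvex_finite_index:
  assumes "quasiconvex G X H" and fi: "finite_index_subgroup A (G\<lparr>carrier := H\<rparr>)"
  shows "quasiconvex G X A"
proof -
  obtain \<mu> where mu: "0 \<le> \<mu>" and nbhd: "\<And>a b p. a \<in> H \<Longrightarrow> b \<in> H \<Longrightarrow> cayley_geodesic G X a p b \<Longrightarrow>
      path_verts G X a p \<subseteq> cayley_nbhd G X \<mu> H"
    and H: "subgroup H G"
    using assms(1) unfolding quasiconvex_def by blast
  have A': "subgroup A (G\<lparr>carrier := H\<rparr>)" using fi by (simp add: finite_index_subgroup_def)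
  then have A: "subgroup A G" "A \<subseteq> H"
    using incl_subgroup[OF H A'] subgroup.subset[OF A'] by auto
  have fin: "finite ((\<lambda>h. A #> h) ` H)"
    using fi by (simp add: finite_index_subgroup_def RCOSETS_def r_coset_def image_UN UNION_singleton_eq_range)
  then obtain F where F: "F \<subseteq> H" "finite F" "(\<lambda>h. A #> h) ` H = (\<lambda>h. A #> h) ` F"
    using finite_subset_image[OF fin subset_refl] by auto
  define N where "N = Max (insert 0 (cdist \<one> ` F))"
  have near: "\<exists>a\<in>A. cdist h a \<le> N" if h: "h \<in> H" for h
  proof -
    obtain r where r: "r \<in> F" "A #> h = A #> r" using F h by blast
    have hc: "h \<in> carrier G" using subgroup.mem_carrier[OF H h] .
    then have "h \<in> A #> r" using r(2) rcos_self[OF hc A(1)] by simp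
    then obtain a where a: "a \<in> A" "h = a \<otimes> r" by (auto simp: r_coset_def)
    have c: "a \<in> carrier G" "r \<in> carrier G"
      using a r F subgroup.mem_carrier[OF A(1)] subgroup.mem_carrier[OF H] by auto
    have "cdist h a = cdist \<one> r"
      using cdist_mult[of a r \<one>] c a by (simp add: cdist_commute)
    also have "\<dots> \<le> N" unfolding N_def using r F by (intro Max_ge) auto
    finally show ?thesis using a by blast
  qed
  show ?thesis unfolding quasiconvex_def
  proof (intro conjI exI[of _ "\<mu> + real N"] ballI allI impI subsetI)
    fix a b p v assume ab: "a \<in> A" "b \<in> A" "cayley_geodesic G X a p b" "v \<in> path_verts G X a p"
    then have "v \<in> cayley_nbhd G X \<mu> H" using nbhd A by blast
    then obtain h where h: "v \<in> carrier G" "h \<in> H" "rdist v h \<le> \<mu>" by (auto simp: cayley_nbhd_def)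
    obtain c where c: "c \<in> A" "cdist h c \<le> N" using near h by blast
    have "rdist v c \<le> rdist v h + rdist h c"
      using h c subgroup.mem_carrier[OF A(1)] subgroup.mem_carrier[OF H] by (intro rdist_triangle) auto
    then have "rdist v c \<le> \<mu> + real N" using h c by linarith
    then show "v \<in> cayley_nbhd G X (\<mu> + real N) A" using h c by (auto simp: cayley_nbhd_def)
  qed (use A mu in auto)
qed

text \<open>Pairing a with a chosen close point \<open>f a\<close> of K, the displacement
  \<open>inv a \<otimes> f a\<close> lies in a finite ball. Equal displacements at a and b make
  \<open>b \<otimes> inv a\<close> equal to \<open>f b \<otimes> inv (f a)\<close>, an element of
  both H and K and therefore trivial.\<close>

lemma finite_close_points:
  assumes H: "subgroup H G" and K: "subgroup K G" and HK: "H \<inter> K = {\<one>}"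
  shows "finite {a \<in> H. \<exists>b\<in>K. rdist a b \<le> R}"
proof -
  let ?S = "{a \<in> H. \<exists>b\<in>K. rdist a b \<le> R}"
  have "\<forall>a\<in>?S. \<exists>b. b \<in> K \<and> rdist a b \<le> R" by blast
  from bchoice[OF this] obtain f where f: "\<And>a. a \<in> ?S \<Longrightarrow> f a \<in> K \<and> rdist a (f a) \<le> R" by blast
  have car: "a \<in> carrier G" "f a \<in> carrier G" if "a \<in> ?S" for a
    using f[OF that] that H K subgroup.mem_carrier by auto
  have inj: "inj_on (\<lambda>a. inv a \<otimes> f a) ?S"
  proof (rule inj_onI)
    fix a b assume ab: "a \<in> ?S" "b \<in> ?S" and eq: "inv a \<otimes> f a = inv b \<otimes> f b"
    have "b \<otimes> inv a = b \<otimes> (inv a \<otimes> f a) \<otimes> inv (f a)"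
      using car[OF ab(1)] car[OF ab(2)] by (simp add: m_assoc)
    also have "\<dots> = f b \<otimes> inv (f a)"
      unfolding eq using car[OF ab(1)] car[OF ab(2)] by (simp add: m_assoc[symmetric])
    finally have "b \<otimes> inv a = f b \<otimes> inv (f a)" .
    moreover have "b \<otimes> inv a \<in> H" "f b \<otimes> inv (f a) \<in> K"
      using ab f H K by (auto intro!: subgroup.m_closed subgroup.m_inv_closed)
    ultimately have "b \<otimes> inv a = \<one>" using HK by auto
    then show "a = b" using car[OF ab(1)] car[OF ab(2)] by (metis inv_closed inv_equality inv_inv)
  qed
  have "(\<lambda>a. inv a \<otimes> f a) ` ?S \<subseteq> {g \<in> carrier G. cdist \<one> g \<le> nat \<lfloor>R\<rfloor>}"
  proof (rule image_subsetI)
    fix a assume a: "a \<in> ?S"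
    have "cdist \<one> (inv a \<otimes> f a) = cdist a (f a)" using car[OF a] cdist_one by metis
    moreover have "rdist a (f a) \<le> R" using f[OF a] by simp
    ultimately show "inv a \<otimes> f a \<in> {g \<in> carrier G. cdist \<one> g \<le> nat \<lfloor>R\<rfloor>}"
      using car[OF a] by (simp add: le_nat_floor)
  qed
  from finite_imageD[OF finite_subset[OF this finite_ball] inj] show ?thesis .
qed

section \<open>From thin triangles to the four-point inequality\<close>

lemma thin_triangle:
  assumes thin: "delta_negatively_curved G X \<delta>" and z: "z \<in> carrier G"
    and p: "cayley_geodesic G X x p y" and v: "v \<in> path_verts G X x p"
  shows "\<exists>s\<in>carrier G. rdist v s \<le> \<delta> \<and>
    (cdist x s + cdist s z = cdist x z \<or> cdist y s + cdist s z = cdist y z)"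
proof -
  have xy: "x \<in> carrier G" "y \<in> carrier G" using p awalk_carrier by (auto simp: cayley_geodesic_def)
  obtain q r where qr: "cayley_geodesic G X y q z" "cayley_geodesic G X z r x"
    using geodesic_exists xy z by metis
  have "v \<in> cayley_nbhd G X \<delta> (path_verts G X y q \<union> path_verts G X z r)"
    using thin p qr v unfolding delta_negatively_curved_def by blast
  then obtain s where "s \<in> path_verts G X y q \<union> path_verts G X z r" "rdist v s \<le> \<delta>"
    by (auto simp: cayley_nbhd_def)
  then show ?thesis
    using geodesic_between[OF qr(1)] geodesic_between[OF qr(2)] xy z
    by (intro bexI[of _ s]) (auto simp: cdist_commute add.commute)
qed

text \<open>A discrete connectedness argument along the side from x to y: it starts close to the
  side from x to z, and where it first ceases to be so it must be close to the side from y to z. The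
  extra 1 pays for the step between these two vertices.\<close>

lemma thin_triangle_both:
  assumes thin: "delta_negatively_curved G X \<delta>" "0 \<le> \<delta>" and z: "z \<in> carrier G"
    and p: "cayley_geodesic G X x p y"
  shows "\<exists>v\<in>path_verts G X x p.
    (\<exists>s\<in>carrier G. rdist v s \<le> \<delta> + 1 \<and> cdist x s + cdist s z = cdist x z) \<and>
    (\<exists>s\<in>carrier G. rdist v s \<le> \<delta> + 1 \<and> cdist y s + cdist s z = cdist y z)"
proof -
  have xy: "x \<in> carrier G" "y \<in> carrier G" using p awalk_carrier by (auto simp: cayley_geodesic_def)
  obtain f where f: "\<And>t. t \<le> cdist x y \<Longrightarrow> f t \<in> path_verts G X x p"
    "\<And>t. t \<le> cdist x y \<Longrightarrow> cdist x (f t) = t"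
    "\<And>t. t < cdist x y \<Longrightarrow> cdist (f t) (f (Suc t)) \<le> 1"
    using geodesic_param[OF p] by blast
  have fc: "f t \<in> carrier G" "cdist x (f t) + cdist (f t) y = cdist x y" if "t \<le> cdist x y" for t
    using geodesic_between[OF p] f(1) that by blast+
  define near where "near t \<longleftrightarrow> (\<exists>s\<in>carrier G. rdist (f t) s \<le> \<delta> \<and> cdist x s + cdist s z = cdist x z)" for t
  have near0: "near 0"
    using f(2)[of 0] fc[of 0] xy thin(2) unfolding near_def
    by (intro bexI[of _ x]) (auto simp: cdist_self cdist_commute)
  show ?thesis
  proof (cases "near (cdist x y)")
    case True
    have "rdist (f (cdist x y)) y = 0" using f(2)[of "cdist x y"] fc[of "cdist x y"] by simp
    then have "\<exists>s\<in>carrier G. rdist (f (cdist x y)) s \<le> \<delta> + 1 \<and> cdist y s + cdist s z = cdist y z"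
      using xy thin(2) by (intro bexI[of _ y]) (auto simp: cdist_self)
    moreover have "\<exists>s\<in>carrier G. rdist (f (cdist x y)) s \<le> \<delta> + 1 \<and> cdist x s + cdist s z = cdist x z"
      using True unfolding near_def by force
    ultimately show ?thesis using f(1)[of "cdist x y"] by blast
  next
    case False
    define t where "t = (LEAST t. \<not> near t)"
    have t: "\<not> near t" "t \<le> cdist x y"
      using LeastI[of "\<lambda>t. \<not> near t"] Least_le[of "\<lambda>t. \<not> near t"] False unfolding t_def by blast+
    then obtain k where k: "t = Suc k" using near0 by (cases t) auto
    then have "near k" using not_less_Least[of k "\<lambda>t. \<not> near t"] unfolding t_def by auto
    then obtain s where s: "s \<in> carrier G" "rdist (f k) s \<le> \<delta>" "cdist x s + cdist s z = cdist x z"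
      unfolding near_def by blast
    obtain s' where s': "s' \<in> carrier G" "rdist (f t) s' \<le> \<delta>" "cdist y s' + cdist s' z = cdist y z"
      using thin_triangle[OF thin(1) z p f(1)[OF t(2)]] t(1) unfolding near_def by blast
    have "rdist (f t) s \<le> rdist (f t) (f k) + rdist (f k) s"
      using fc t k s by (intro rdist_triangle) auto
    moreover have "rdist (f t) (f k) \<le> 1"
      using f(3)[of k] fc(1)[of k] fc(1)[of t] t k by (simp add: cdist_commute)
    ultimately have "rdist (f t) s \<le> \<delta> + 1" "rdist (f t) s' \<le> \<delta> + 1" using s s' by linarith+
    then show ?thesis using s s' f(1)[OF t(2)] by blast
  qed
qed

text \<open>Two triangles share the side from x to y. The vertex v of that side is close to both
  other sides of the triangle with apex z, and to one side of the triangle with apex w; that side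
  decides which of the two sums dominates.\<close>

lemma negatively_curved_hyperbolic_space:
  assumes thin: "delta_negatively_curved G X \<delta>" "0 \<le> \<delta>"
  shows "hyperbolic_space (carrier G) rdist (2 * \<delta> + 1)"
proof
  fix x y z w assume c: "x \<in> carrier G" "y \<in> carrier G" "z \<in> carrier G" "w \<in> carrier G"
  obtain p where p: "cayley_geodesic G X x p y" using geodesic_exists c by blast
  obtain v s t where v: "v \<in> path_verts G X x p"
    and s: "s \<in> carrier G" "rdist v s \<le> \<delta> + 1" "cdist x s + cdist s z = cdist x z"
    and t: "t \<in> carrier G" "rdist v t \<le> \<delta> + 1" "cdist y t + cdist t z = cdist y z"
    using thin_triangle_both[OF thin c(3) p] by blast
  obtain u where u: "u \<in> carrier G" "rdist v u \<le> \<delta>"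
      "cdist x u + cdist u w = cdist x w \<or> cdist y u + cdist u w = cdist y w"
    using thin_triangle[OF thin(1) c(4) p v] by blast
  have vc: "v \<in> carrier G" and vb: "cdist x v + cdist v y = cdist x y"
    using geodesic_between[OF p v] by auto
  \<comment> \<open>Here i lies towards a on a geodesic from x, and j towards b on one from y. Both
    the path from x to y and the path from a to b detour through i, v and j, so the error is twice
    \<open>2 * \<delta> + 1\<close>: one point is within \<open>\<delta>\<close> of v, the other
    within \<open>\<delta> + 1\<close>.\<close>
  have cross: "rdist x y + rdist z w \<le> (rdist x i + rdist i a) + (rdist y j + rdist j b) + 4 * \<delta> + 2"
    if "{a, b} = {z, w}" "i \<in> carrier G" "j \<in> carrier G" "rdist v i + rdist v j \<le> 2 * \<delta> + 1" for a b i j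
  proof -
    have ab: "a \<in> carrier G" "b \<in> carrier G" using that c by (auto simp: doubleton_eq_iff)
    have "rdist z w = rdist a b" using that c by (auto simp: doubleton_eq_iff cdist_commute)
    moreover have "rdist a b \<le> rdist a i + rdist i b" "rdist i b \<le> rdist i j + rdist j b"
        "rdist i j \<le> rdist i v + rdist v j" "rdist x v \<le> rdist x i + rdist i v"
        "rdist v y \<le> rdist v j + rdist j y"
      using that ab c vc by (auto intro!: rdist_triangle)
    moreover have "rdist x y = rdist x v + rdist v y" using vb by linarith
    moreover have "rdist a i = rdist i a" "rdist i v = rdist v i" "rdist j y = rdist y j"
      using that ab c vc by (simp_all add: cdist_commute)
    ultimately show ?thesis using that(4) by linarith
  qed
  show "rdist x y + rdist z w \<le> max (rdist x z + rdist y w) (rdist x w + rdist y z) + 2 * (2 * \<delta> + 1)"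
  proof (cases "cdist x u + cdist u w = cdist x w")
    case True
    then have "rdist x u + rdist u w = rdist x w" "rdist y t + rdist t z = rdist y z"
      using t by linarith+
    moreover have "rdist x y + rdist z w \<le> (rdist x u + rdist u w) + (rdist y t + rdist t z) + 4 * \<delta> + 2"
      by (rule cross) (use u t in auto)
    ultimately have "rdist x y + rdist z w \<le> (rdist x w + rdist y z) + 2 * (2 * \<delta> + 1)"
      by argo
    from order_trans[OF this add_right_mono[OF max.cobounded2]] show ?thesis .
  next
    case False
    then have "rdist y u + rdist u w = rdist y w" "rdist x s + rdist s z = rdist x z"
      using u s by linarith+
    moreover have "rdist x y + rdist z w \<le> (rdist x s + rdist s z) + (rdist y u + rdist u w) + 4 * \<delta> + 2"
      by (rule cross) (use u s in auto)
    ultimately have "rdist x y + rdist z w \<le> (rdist x z + rdist y w) + 2 * (2 * \<delta> + 1)"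
      by argo
    from order_trans[OF this add_right_mono[OF max.cobounded1]] show ?thesis .
  qed
qed (use thin in \<open>auto intro: rdist_triangle simp: cdist_commute cdist_self\<close>)

end

section \<open>Bounded Gromov products between two subgroups\<close>

locale hyperbolic_group =
  cayley G X + hyperbolic_space "carrier G" "\<lambda>a b. real (cayley_dist G X a b)" \<Delta>
  for G :: "('a, 'm) monoid_scheme" (structure) and X :: "'a set" and \<Delta> :: real
begin

lemma gromov_mult:
  "g \<in> carrier G \<Longrightarrow> a \<in> carrier G \<Longrightarrow> b \<in> carrier G \<Longrightarrow> gromov (g \<otimes> a) (g \<otimes> b) g = gromov a b \<one>"
  using cdist_mult[of g a \<one>] cdist_mult[of g b \<one>] by (simp add: gromov_def cdist_mult)

lemma gromov_bounded:
  assumes qH: "quasiconvex G X H" and qK: "quasiconvex G X K" and HK: "H \<inter> K = {\<one>}"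
  shows "\<exists>C\<ge>0. \<forall>h\<in>H. \<forall>k\<in>K. gromov h k \<one> \<le> C"
proof -
  obtain \<mu> where mu: "0 \<le> \<mu>" and H: "\<And>a b t. a \<in> H \<Longrightarrow> b \<in> H \<Longrightarrow> t \<le> cdist a b \<Longrightarrow>
      \<exists>v\<in>carrier G. cdist a v = t \<and> cdist a v + cdist v b = cdist a b \<and> (\<exists>h\<in>H. rdist v h \<le> \<mu>)"
    by (rule quasiconvex_geodesic[OF qH]) blast
  obtain \<nu> where nu: "0 \<le> \<nu>" and K: "\<And>a b t. a \<in> K \<Longrightarrow> b \<in> K \<Longrightarrow> t \<le> cdist a b \<Longrightarrow>
      \<exists>v\<in>carrier G. cdist a v = t \<and> cdist a v + cdist v b = cdist a b \<and> (\<exists>h\<in>K. rdist v h \<le> \<nu>)"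
    by (rule quasiconvex_geodesic[OF qK]) blast
  have sub: "subgroup H G" "subgroup K G" using qH qK by (auto simp: quasiconvex_def)
  have car: "H \<subseteq> carrier G" "K \<subseteq> carrier G" using sub subgroup.subset by auto
  \<comment> \<open>The route from a to b passes through p and q: \<open>\<mu>\<close> and
    \<open>\<nu>\<close> at its ends, and \<open>4 * \<Delta>\<close> between two points at equal
    height on geodesics that still run together.\<close>
  define R where "R = 4 * \<Delta> + \<mu> + \<nu>"
  let ?S = "{a \<in> H. \<exists>b\<in>K. rdist a b \<le> R}"
  define N where "N = Max (insert 0 (cdist \<one> ` ?S))"
  have N: "cdist \<one> a \<le> N" if "a \<in> ?S" for a
    unfolding N_def using that finite_close_points[OF sub HK] by (intro Max_ge) auto
  show ?thesis
  proof (intro exI[of _ "N + \<mu> + 1"] conjI ballI)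
    show "0 \<le> real N + \<mu> + 1" using mu by simp
    fix h k assume hk: "h \<in> H" "k \<in> K"
    have c: "h \<in> carrier G" "k \<in> carrier G" using hk car by auto
    have one: "\<one> \<in> H" "\<one> \<in> K" using HK by auto
    have tri: "cdist h k \<le> cdist \<one> h + cdist \<one> k" "cdist \<one> h \<le> cdist \<one> k + cdist h k"
        "cdist \<one> k \<le> cdist \<one> h + cdist h k"
      using cdist_triangle[of h \<one> k] cdist_triangle[of \<one> k h] cdist_triangle[of \<one> h k] c
        cdist_commute[of h \<one>] cdist_commute[of h k] by auto
    \<comment> \<open>The product is half of the integer n, and vertices exist only at integer
      distances; rounding down costs at most 1/2, covered by the final \<open>+ 1\<close>.\<close>
    define n where "n = cdist \<one> h + cdist \<one> k - cdist h k"
    define t where "t = n div 2"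
    have n: "rdist \<one> h + rdist \<one> k - rdist h k = real n" "n \<le> 2 * cdist \<one> h" "n \<le> 2 * cdist \<one> k"
      using tri by (auto simp: n_def)
    have t: "t \<le> cdist \<one> h" "t \<le> cdist \<one> k" "2 * t \<le> n" "n \<le> 2 * t + 1"
      using n by (auto simp: t_def)
    obtain p a where p: "p \<in> carrier G" "cdist \<one> p = t" "cdist \<one> p + cdist p h = cdist \<one> h"
        "a \<in> H" "rdist p a \<le> \<mu>" using H[OF one(1) hk(1) t(1)] by blast
    obtain q b where q: "q \<in> carrier G" "cdist \<one> q = t" "cdist \<one> q + cdist q k = cdist \<one> k"
        "b \<in> K" "rdist q b \<le> \<nu>" using K[OF one(2) hk(2) t(2)] by blast
    have ab: "a \<in> carrier G" "b \<in> carrier G" using p q car by auto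
    have g: "gromov h k \<one> = (rdist \<one> h + rdist \<one> k - rdist h k) / 2"
      using c by (simp add: gromov_def cdist_commute)
    have t_le: "t \<le> gromov h k \<one>" and le_t: "gromov h k \<one> \<le> t + 1"
      unfolding g n using t(3,4) by linarith+
    have "gromov p h \<one> = t"
      using p c cdist_commute[of p \<one>] cdist_commute[of h \<one>] by (simp add: gromov_def flip: p(3))
    moreover have "gromov k q \<one> = t"
      using q c cdist_commute[of q \<one>] cdist_commute[of k \<one>] cdist_commute[of q k]
      by (simp add: gromov_def flip: q(3))
    \<comment> \<open>The chain p, h, k, q has all consecutive products at \<open>\<one>\<close> at
      least t, and two applications of the hyperbolic inequality lose \<open>2 * \<Delta>\<close>.
      As p and q both have distance t from \<open>\<one>\<close>, this bounds their
      distance.\<close>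
    ultimately have "t - 2 * \<Delta> \<le> gromov p q \<one>"
      using gromov_hyp[of p h k \<one>] gromov_hyp[of p k q \<one>] p q c t_le delta_nonneg
      by (auto simp: min_def split: if_splits)
    then have "rdist p q \<le> 4 * \<Delta>"
      using p q cdist_commute[of p \<one>] cdist_commute[of q \<one>] by (simp add: gromov_def field_simps)
    moreover have "rdist a b \<le> rdist a p + rdist p b" "rdist p b \<le> rdist p q + rdist q b"
      using p q ab by (intro rdist_triangle; simp)+
    moreover have "rdist a p = rdist p a" using p ab by (simp add: cdist_commute)
    ultimately have "rdist a b \<le> R" unfolding R_def using p q by linarith
    then have "cdist \<one> a \<le> N" using N p q by blast
    moreover have "rdist \<one> p \<le> rdist \<one> a + rdist a p"
      using p ab by (intro rdist_triangle) simp_all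
    moreover have "rdist a p = rdist p a" using p ab by (simp add: cdist_commute)
    ultimately show "gromov h k \<one> \<le> real N + \<mu> + 1" using le_t p by linarith
  qed
qed

end

section \<open>Reduced words\<close>

definition reduced_word :: "('a, 'm) monoid_scheme \<Rightarrow> ('b, 'n) monoid_scheme \<Rightarrow> ('a + 'b) list \<Rightarrow> bool" where
  "reduced_word A B w \<longleftrightarrow> w \<in> free_product_words A B \<and> Inl \<one>\<^bsub>A\<^esub> \<notin> set w \<and> Inr \<one>\<^bsub>B\<^esub> \<notin> set w \<and>
    successively (\<lambda>x y. isl x \<noteq> isl y) w"

text \<open>One merge and one deletion suffice: if the merged letter is trivial, the remaining tail
  is already reduced; otherwise it belongs to the same factor as the letter it replaces, so
  alternation survives.\<close>

lemma reduced_word_Cons: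
  assumes "group A" "group B" "x \<in> carrier A <+> carrier B" "reduced_word A B r"
  shows "\<exists>s. (x # r, s) \<in> free_product_cong A B \<and> reduced_word A B s"
proof -
  interpret A: group A by fact
  interpret B: group B by fact
  let ?R = "free_product_cong A B"
  have rw: "r \<in> free_product_words A B" using assms(4) by (simp add: reduced_word_def)
  have xr: "x # r \<in> free_product_words A B" using assms(3) rw by simp
  have del: "(y # t, t) \<in> ?R" if "([y], []) \<in> ?R" "t \<in> free_product_words A B" for y t
    using free_product_cong.app[OF that(1) free_product_cong.refl[OF that(2)]] by simp
  have contract: "(y # z # t, u # t) \<in> ?R" if "([y, z], [u]) \<in> ?R" "t \<in> free_product_words A B" for y z u t
    using free_product_cong.app[OF that(1) free_product_cong.refl[OF that(2)]] by simp
  have reduced_tl: "reduced_word A B t" if "reduced_word A B (y # t)" for y t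
    using that by (auto simp: reduced_word_def successively_Cons)
  consider (one) "([x], []) \<in> ?R"
    | (new) "x \<noteq> Inl \<one>\<^bsub>A\<^esub>" "x \<noteq> Inr \<one>\<^bsub>B\<^esub>" "r = [] \<or> isl x \<noteq> isl (hd r)"
    | (merge) y t where "r = y # t" "isl x = isl y"
    using free_product_cong.one_left[of A B] free_product_cong.one_right[of B A] by (cases r) auto
  then show ?thesis
  proof cases
    case one
    then show ?thesis using del[OF one rw] assms(4) by blast
  next
    case new
    then have "reduced_word A B (x # r)"
      using xr assms(4) unfolding reduced_word_def by (auto simp: successively_Cons)
    then show ?thesis using free_product_cong.refl[OF xr] by blast
  next
    case merge: (merge y t)
    then have t: "t \<in> free_product_words A B" "y \<in> carrier A <+> carrier B" using rw by auto
    obtain u where u: "([x, y], [u]) \<in> ?R" "u \<in> carrier A <+> carrier B" "isl u = isl y"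
    proof (cases x)
      case (Inl a)
      then obtain b where "y = Inl b" using merge by (cases y) auto
      then show ?thesis using that[of "Inl (a \<otimes>\<^bsub>A\<^esub> b)"] Inl assms(3) t
        by (auto intro: free_product_cong.mult_left)
    next
      case (Inr a)
      then obtain b where "y = Inr b" using merge by (cases y) auto
      then show ?thesis using that[of "Inr (a \<otimes>\<^bsub>B\<^esub> b)"] Inr assms(3) t
        by (auto intro: free_product_cong.mult_right)
    qed
    have cong: "(x # r, u # t) \<in> ?R" using contract[OF u(1) t(1)] merge by simp
    show ?thesis
    proof (cases "u = Inl \<one>\<^bsub>A\<^esub> \<or> u = Inr \<one>\<^bsub>B\<^esub>")
      case True
      then have "(u # t, t) \<in> ?R"
        using del[OF _ t(1)] free_product_cong.one_left[of A B] free_product_cong.one_right[of B A] by blast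
      then show ?thesis using free_product_cong.trans[OF cong] reduced_tl[of y t] assms(4) merge by blast
    next
      case False
      then have "reduced_word A B (u # t)"
        using assms(4) merge u t unfolding reduced_word_def by (auto simp: successively_Cons)
      then show ?thesis using cong by blast
    qed
  qed
qed

lemma reduced_word_exists:
  assumes "group A" "group B" "w \<in> free_product_words A B"
  shows "\<exists>r. (w, r) \<in> free_product_cong A B \<and> reduced_word A B r"
  using assms(3)
proof (induction w)
  case Nil
  have "([], []) \<in> free_product_cong A B" by (rule free_product_cong.refl) simp
  then show ?case by (auto simp: reduced_word_def)
next
  case (Cons x w)
  then obtain r where r: "(w, r) \<in> free_product_cong A B" "reduced_word A B r" by auto
  have x: "x \<in> carrier A <+> carrier B" using Cons by auto
  obtain s where s: "(x # r, s) \<in> free_product_cong A B" "reduced_word A B s"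
    using reduced_word_Cons[OF assms(1,2) x r(2)] by blast
  have "[x] \<in> free_product_words A B" using x by simp
  from free_product_cong.app[OF free_product_cong.refl[OF this] r(1)]
  have "(x # w, x # r) \<in> free_product_cong A B" by simp
  then show ?case using s free_product_cong.trans by blast
qed

section \<open>Evaluation of words in two subgroups\<close>

locale subgroup_pair = group G for G :: "('a, 'm) monoid_scheme" (structure) +
  fixes A B :: "'a set"
  assumes subgroup_A: "subgroup A G" and subgroup_B: "subgroup B G"
begin

abbreviation "GA \<equiv> G\<lparr>carrier := A\<rparr>"
abbreviation "GB \<equiv> G\<lparr>carrier := B\<rparr>"
abbreviation "eval_word \<equiv> word_value G (\<lambda>a. a) (\<lambda>b. b)"

lemma groups: "group GA" "group GB"
  using subgroup_A subgroup_B subgroup_imp_group by auto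

lemma inclusions: "(\<lambda>a. a) \<in> hom GA G" "(\<lambda>b. b) \<in> hom GB G"
  using subgroup.subset[OF subgroup_A] subgroup.subset[OF subgroup_B] by (auto simp: hom_def)

lemmas eval_word_closed = word_value_closed[OF groups is_group inclusions]
  and eval_word_append = word_value_append[OF groups is_group inclusions]
  and eval_word_cong = word_value_cong[OF groups is_group inclusions]

lemma eval_word_surj:
  assumes "g \<in> generate G (A \<union> B)"
  shows "\<exists>w\<in>free_product_words GA GB. eval_word w = g"
  using assms
proof (induction rule: generate.induct)
  case one
  show ?case by (intro bexI[of _ "[]"]) auto
next
  case (incl h)
  then show ?case
  proof
    assume "h \<in> A"
    then show ?thesis using subgroup.mem_carrier[OF subgroup_A]
      by (intro bexI[of _ "[Inl h]"]) auto
  next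
    assume "h \<in> B"
    then show ?thesis using subgroup.mem_carrier[OF subgroup_B]
      by (intro bexI[of _ "[Inr h]"]) auto
  qed
next
  case (inv h)
  then show ?case
  proof
    assume "h \<in> A"
    then show ?thesis using subgroup.mem_carrier[OF subgroup_A] subgroup.m_inv_closed[OF subgroup_A]
      by (intro bexI[of _ "[Inl (inv h)]"]) auto
  next
    assume "h \<in> B"
    then show ?thesis using subgroup.mem_carrier[OF subgroup_B] subgroup.m_inv_closed[OF subgroup_B]
      by (intro bexI[of _ "[Inr (inv h)]"]) auto
  qed
next
  case (eng h k)
  then obtain v w where "v \<in> free_product_words GA GB" "w \<in> free_product_words GA GB"
    "eval_word v = h" "eval_word w = k" by blast
  then show ?case
    using eval_word_append by (intro bexI[of _ "v @ w"]) (simp_all del: in_lists_conv_set add: append_in_lists_conv)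
qed

lemma eval_reduced_word_surj:
  assumes "g \<in> generate G (A \<union> B)"
  obtains w where "reduced_word GA GB w" "eval_word w = g"
  using eval_word_surj[OF assms] reduced_word_exists[OF groups] eval_word_cong by metis

lemma eval_word_generate:
  "w \<in> free_product_words GA GB \<Longrightarrow> eval_word w \<in> generate G (A \<union> B)"
proof (induction w)
  case Nil
  then show ?case by (simp add: generate.one)
next
  case (Cons x w)
  then have w: "eval_word w \<in> generate G (A \<union> B)" by simp
  show ?case
  proof (cases x)
    case (Inl a)
    then have "a \<in> A" using Cons by auto
    then show ?thesis using Inl w by (auto intro!: generate.eng[OF generate.incl])
  next
    case (Inr b)
    then have "b \<in> B" using Cons by auto
    then show ?thesis using Inr w by (auto intro!: generate.eng[OF generate.incl])
  qed
qed

lemma subgroup_join: "subgroup (generate G (A \<union> B)) G"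
  using subgroup.subset[OF subgroup_A] subgroup.subset[OF subgroup_B] by (simp add: generate_is_subgroup)

text \<open>Injectivity is tested on the kernel, and each kernel class has a reduced representative
  with value \<open>\<one>\<close>, which the hypothesis forces to be empty.\<close>

lemma generates_free_productI:
  assumes nontriv: "\<And>w. reduced_word GA GB w \<Longrightarrow> w \<noteq> [] \<Longrightarrow> eval_word w \<noteq> \<one>"
  shows "generates_free_product G A B"
proof -
  define J where "J = G\<lparr>carrier := generate G (A \<union> B)\<rparr>"
  let ?P = "free_product GA GB" and ?f = "free_product_lift J (\<lambda>a. a) (\<lambda>b. b)"
    and ?R = "free_product_cong GA GB"
  have J: "group J" unfolding J_def using subgroup_imp_group[OF subgroup_join] .
  have incl: "(\<lambda>a. a) \<in> hom GA J" "(\<lambda>b. b) \<in> hom GB J"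
    by (auto simp: hom_def J_def intro: generate.incl)
  have val: "word_value J (\<lambda>a. a) (\<lambda>b. b) w = eval_word w" for w
  proof (induction w)
    case (Cons x w)
    then show ?case by (cases x) (auto simp: J_def)
  qed (simp add: J_def)
  have lift: "?f (?R `` {w}) = eval_word w" if "w \<in> free_product_words GA GB" for w
    using free_product_lift_class[OF groups J incl that] val by simp
  have hom: "?f \<in> hom ?P J"
    using free_product_lift_hom[OF groups J incl] .
  interpret f: group_hom ?P J ?f
    using hom J group_free_product[OF groups] by (simp add: group_hom_def group_hom_axioms_def)
  have "?f \<in> iso ?P J" unfolding f.iso_iff
  proof (intro conjI ballI impI)
    show "carrier J \<subseteq> ?f ` carrier ?P"
    proof
      fix g assume "g \<in> carrier J"
      then obtain w where w: "w \<in> free_product_words GA GB" "eval_word w = g"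
        using eval_word_surj by (auto simp: J_def)
      then have "?R `` {w} \<in> carrier ?P" by (auto simp: free_product_def intro: quotientI)
      then show "g \<in> ?f ` carrier ?P" using lift[OF w(1)] w(2) by (metis imageI)
    qed
  next
    fix P assume P: "P \<in> carrier ?P" and "?f P = \<one>\<^bsub>J\<^esub>"
    obtain w where w: "w \<in> free_product_words GA GB" "P = ?R `` {w}"
      using P by (auto simp: free_product_def elim!: quotientE)
    obtain r where r: "(w, r) \<in> ?R" "reduced_word GA GB r"
      using reduced_word_exists[OF groups w(1)] by blast
    have "P = ?R `` {r}" using w r equiv_class_eq[OF equiv_free_product_cong[OF groups]] by metis
    moreover have "eval_word r = \<one>"
      using lift w \<open>?f P = \<one>\<^bsub>J\<^esub>\<close> eval_word_cong[OF r(1)] by (simp add: J_def)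
    ultimately show "P = \<one>\<^bsub>?P\<^esub>" using nontriv[OF r(2)] by (cases "r = []") (auto simp: free_product_def)
  qed
  then show ?thesis unfolding generates_free_product_def J_def Let_def .
qed

end

section \<open>Joins of subgroups with long nontrivial elements\<close>

context hyperbolic_group
begin

context
  fixes A B :: "'a set" and C L :: real
  assumes sub: "subgroup A G" "subgroup B G"
    and C: "0 \<le> C" "\<And>a b. a \<in> A \<Longrightarrow> b \<in> B \<Longrightarrow> gromov a b \<one> \<le> C"
    and L: "2 * C + 3 * \<Delta> < L"
    and longA: "\<And>a. a \<in> A \<Longrightarrow> a \<noteq> \<one> \<Longrightarrow> L \<le> rdist \<one> a"
    and longB: "\<And>b. b \<in> B \<Longrightarrow> b \<noteq> \<one> \<Longrightarrow> L \<le> rdist \<one> b"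
begin

interpretation subgroup_pair G A B
  by (rule subgroup_pair.intro[OF is_group subgroup_pair_axioms.intro[OF sub]])

text \<open>Translating a corner to \<open>\<one>\<close> makes its two neighbours the inverse of
  one letter and the next letter. These lie in different subgroups by alternation, so
  \<open>C\<close> bounds their product. The free base point g allows paths between arbitrary points
  of the join.\<close>

lemma reduced_word_broken_path:
  assumes w: "reduced_word GA GB w" and g: "g \<in> carrier G"
  shows "broken_path (\<lambda>i. g \<otimes> eval_word (take i w)) (length w) C L"
proof -
  let ?x = "\<lambda>i. g \<otimes> eval_word (take i w)"
  define l where "l i = eval_word [w ! i]" for i
  have words: "w \<in> free_product_words GA GB" using w by (simp add: reduced_word_def)
  then have take: "take i w \<in> free_product_words GA GB" for i by (auto dest: in_set_takeD)
  have car: "?x i \<in> carrier G" for i using eval_word_closed[OF take] g by simp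
  have letter: "(isl (w ! i) \<longrightarrow> l i \<in> A) \<and> (\<not> isl (w ! i) \<longrightarrow> l i \<in> B) \<and> l i \<noteq> \<one>" if "i < length w" for i
  proof -
    have "w ! i \<in> A <+> B" "w ! i \<noteq> Inl \<one>" "w ! i \<noteq> Inr \<one>"
      using that w nth_mem[OF that] unfolding reduced_word_def by (auto simp del: nth_mem)
    then show ?thesis
      using subgroup.mem_carrier[OF sub(1)] subgroup.mem_carrier[OF sub(2)] by (auto simp: l_def)
  qed
  have lcar: "l i \<in> carrier G" if "i < length w" for i
    using letter[OF that] subgroup.mem_carrier[OF sub(1)] subgroup.mem_carrier[OF sub(2)] by blast
  have Suc: "?x (Suc i) = ?x i \<otimes> l i" if "i < length w" for i
  proof -
    have "[w ! i] \<in> free_product_words GA GB" using words that nth_mem by (auto simp del: nth_mem)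
    then have "eval_word (take (Suc i) w) = eval_word (take i w) \<otimes> l i"
      using eval_word_append[OF take] that by (simp add: take_Suc_conv_app_nth l_def)
    then show ?thesis using g eval_word_closed[OF take] lcar[OF that] by (simp add: m_assoc)
  qed
  show ?thesis unfolding broken_path_def
  proof (intro conjI allI impI)
    fix i assume i: "i < length w"
    have "cdist (?x i) (?x (Suc i)) = cdist \<one> (l i)"
      unfolding Suc[OF i] using cdist_mult[OF car[of i] one_closed lcar[OF i]] car[of i] by simp
    moreover have "L \<le> rdist \<one> (l i)" using letter[OF i] longA longB by blast
    ultimately show "L \<le> rdist (?x i) (?x (Suc i))" by simp
  next
    fix i assume i: "Suc i < length w"
    let ?g = "?x (Suc i)"
    have "?x i = ?g \<otimes> inv (l i)"
      using Suc[of i] lcar[of i] car[of i] i by (simp add: m_assoc)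
    then have "gromov (?x i) (?x (Suc (Suc i))) ?g = gromov (inv (l i)) (l (Suc i)) \<one>"
      using gromov_mult[OF car[of "Suc i"], of "inv (l i)" "l (Suc i)"] Suc[OF i] lcar[OF i] lcar[of i] i
      by simp
    moreover have "isl (w ! i) \<noteq> isl (w ! Suc i)"
      using w i successively_nth[of "\<lambda>x y. isl x \<noteq> isl y"] unfolding reduced_word_def by blast
    then have "(inv (l i) \<in> A \<and> l (Suc i) \<in> B) \<or> (inv (l i) \<in> B \<and> l (Suc i) \<in> A)"
      using letter[OF i] letter[of i] i subgroup.m_inv_closed[OF sub(1)] subgroup.m_inv_closed[OF sub(2)]
      by auto
    then have "gromov (inv (l i)) (l (Suc i)) \<one> \<le> C"
    proof (elim disjE conjE)
      assume "inv (l i) \<in> B" "l (Suc i) \<in> A"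
      moreover have "gromov (inv (l i)) (l (Suc i)) \<one> = gromov (l (Suc i)) (inv (l i)) \<one>"
        using lcar[OF i] lcar[of i] i by (intro gromov_commute) auto
      ultimately show ?thesis using C(2) by metis
    qed (rule C(2))
    ultimately show "gromov (?x i) (?x (Suc (Suc i))) (?x (Suc i)) \<le> C" by simp
  qed (use car in auto)
qed

lemma long_subgroups_free_product: "generates_free_product G A B"
proof (rule generates_free_productI)
  fix w assume w: "reduced_word GA GB w" "w \<noteq> []"
  have "0 < rdist (\<one> \<otimes> eval_word (take 0 w)) (\<one> \<otimes> eval_word (take (length w) w))"
    using broken_path_grows[OF C(1) L reduced_word_broken_path[OF w(1) one_closed]] w(2) by simp
  then show "eval_word w \<noteq> \<one>" by (auto simp: cdist_self)
qed

lemma long_subgroups_quasiconvex: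
  assumes qA: "quasiconvex G X A" and qB: "quasiconvex G X B"
  shows "quasiconvex G X (generate G (A \<union> B))"
proof -
  let ?J = "generate G (A \<union> B)"
  obtain \<mu> where mu: "0 \<le> \<mu>" and nearA: "\<And>a b t. a \<in> A \<Longrightarrow> b \<in> A \<Longrightarrow> t \<le> cdist a b \<Longrightarrow>
      \<exists>v\<in>carrier G. cdist a v = t \<and> cdist a v + cdist v b = cdist a b \<and> (\<exists>h\<in>A. rdist v h \<le> \<mu>)"
    by (rule quasiconvex_geodesic[OF qA]) blast
  obtain \<nu> where nu: "0 \<le> \<nu>" and nearB: "\<And>a b t. a \<in> B \<Longrightarrow> b \<in> B \<Longrightarrow> t \<le> cdist a b \<Longrightarrow>
      \<exists>v\<in>carrier G. cdist a v = t \<and> cdist a v + cdist v b = cdist a b \<and> (\<exists>h\<in>B. rdist v h \<le> \<nu>)"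
    by (rule quasiconvex_geodesic[OF qB]) blast
  have AB: "A \<subseteq> ?J" "B \<subseteq> ?J" by (auto intro: generate.incl)
  have J: "subgroup ?J G" by (rule subgroup_join)
  have near: "\<exists>q\<in>carrier G. cdist \<one> q = t \<and> cdist \<one> q + cdist q l = cdist \<one> l \<and>
      (\<exists>h\<in>?J. rdist q h \<le> \<mu> + \<nu>)" if "l \<in> A \<union> B" "t \<le> cdist \<one> l" for l t
    using that(1)
  proof
    assume "l \<in> A"
    from nearA[OF subgroup.one_closed[OF sub(1)] this that(2)] show ?thesis
      using AB nu by (meson add_increasing2 subsetD)
  next
    assume "l \<in> B"
    from nearB[OF subgroup.one_closed[OF sub(2)] this that(2)] show ?thesis
      using AB mu by (meson add_increasing subsetD)
  qed
  \<comment> \<open>The first two terms are the bound of \<open>dist_le_gromov\<close> at a product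
    of \<open>2 * C + 6 * \<Delta>\<close>; \<open>\<mu> + \<nu>\<close> leads from an edge to the
    join, whichever subgroup its letter belongs to.\<close>
  define E where "E = 2 * (2 * C + 6 * \<Delta>) + 2 * \<Delta> + \<mu> + \<nu>"
  show ?thesis
  proof (rule quasiconvexI[OF J])
    show "0 \<le> E" using C(1) delta_nonneg mu nu by (simp add: E_def)
    fix a b v assume a: "a \<in> ?J" and b: "b \<in> ?J" and v: "v \<in> carrier G"
      and between: "cdist a v + cdist v b = cdist a b"
    have ab: "a \<in> carrier G" "b \<in> carrier G" using a b subgroup.mem_carrier[OF J] by auto
    have "inv a \<otimes> b \<in> ?J" using a b J by (simp add: subgroup.m_closed subgroup.m_inv_closed)
    then obtain w where w: "reduced_word GA GB w" "eval_word w = inv a \<otimes> b"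
      by (rule eval_reduced_word_surj)
    have words: "w \<in> free_product_words GA GB" using w by (simp add: reduced_word_def)
    then have take: "take i w \<in> free_product_words GA GB" for i by (auto dest: in_set_takeD)
    let ?x = "\<lambda>i. a \<otimes> eval_word (take i w)"
    have ends: "?x 0 = a" "?x (length w) = b" using w ab by (simp_all add: m_assoc[symmetric])
    show "\<exists>h\<in>?J. rdist v h \<le> E"
    proof (cases "w = []")
      case True
      then have "a = b" using ends by simp
      then have "rdist v a \<le> E" using between \<open>0 \<le> E\<close> ab by (simp add: cdist_self)
      then show ?thesis using a by blast
    next
      case False
      obtain i where i: "i < length w" "gromov (?x i) (?x (Suc i)) v \<le> 2 * C + 6 * \<Delta>"
        using broken_path_shadows_geodesic[OF C(1) L reduced_word_broken_path[OF w(1) ab(1)] _ v]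
          False between unfolding ends by auto
      define g where "g = ?x i"
      have gJ: "g \<in> ?J"
        unfolding g_def using a eval_word_generate[OF take] by (intro generate.eng)
      then have g: "g \<in> carrier G" using subgroup.mem_carrier[OF J] by blast
      define l where "l = eval_word [w ! i]"
      have wi: "w ! i \<in> A <+> B" using words i nth_mem[of i w] by (auto simp del: nth_mem)
      then have l: "l \<in> A \<union> B" "l \<in> carrier G"
        using subgroup.mem_carrier[OF sub(1)] subgroup.mem_carrier[OF sub(2)] by (auto simp: l_def)
      have "[w ! i] \<in> free_product_words GA GB" using wi by auto
      then have Suc: "?x (Suc i) = g \<otimes> l"
        using eval_word_append[OF take] i ab eval_word_closed[OF take] l
        by (simp add: take_Suc_conv_app_nth l_def g_def m_assoc)
      \<comment> \<open>The point q is chosen on a geodesic from \<open>\<one>\<close> to the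
        letter, at the height demanded by \<open>dist_le_gromov\<close>; translation by g carries it
        to the edge that v passes.\<close>
      obtain q h where q: "q \<in> carrier G" "cdist \<one> q = min (cdist g v) (cdist \<one> l)"
          "cdist \<one> q + cdist q l = cdist \<one> l" "h \<in> ?J" "rdist q h \<le> \<mu> + \<nu>"
        using near[OF l(1), of "min (cdist g v) (cdist \<one> l)"] by auto
      have h: "h \<in> carrier G" using q subgroup.mem_carrier[OF J] by blast
      have d: "cdist g (g \<otimes> q) = cdist \<one> q" "cdist (g \<otimes> q) (g \<otimes> l) = cdist q l"
          "cdist g (g \<otimes> l) = cdist \<one> l" "cdist (g \<otimes> q) (g \<otimes> h) = cdist q h"
        using cdist_mult[OF g one_closed q(1)] cdist_mult[OF g one_closed l(2)]
          cdist_mult[OF g q(1) l(2)] cdist_mult[OF g q(1) h] g by auto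
      have "rdist v (g \<otimes> q) \<le> 2 * gromov g (g \<otimes> l) v + 2 * \<Delta>"
        using g l q v d by (intro dist_le_gromov) auto
      moreover have "gromov g (g \<otimes> l) v \<le> 2 * C + 6 * \<Delta>" using i(2) Suc by (simp add: g_def)
      moreover have "rdist v (g \<otimes> h) \<le> rdist v (g \<otimes> q) + rdist (g \<otimes> q) (g \<otimes> h)"
        using g q h v by (intro rdist_triangle) auto
      moreover have "rdist (g \<otimes> q) (g \<otimes> h) \<le> \<mu> + \<nu>" using d(4) q(5) by simp
      ultimately have "rdist v (g \<otimes> h) \<le> E" unfolding E_def by argo
      moreover have "g \<otimes> h \<in> ?J" using gJ q by (intro generate.eng)
      ultimately show ?thesis by blast
    qed
  qed
qed

end

end

section \<open>Residual finiteness and the choice of subgroups\<close>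

lemma infinite_finite_index_subgroup:
  assumes "group K" "infinite (carrier K)" "finite_index_subgroup N K"
  shows "infinite N"
proof
  assume "finite N"
  interpret K: group K by fact
  have N: "subgroup N K" "finite (rcosets\<^bsub>K\<^esub> N)"
    using assms(3) by (auto simp: finite_index_subgroup_def)
  have "finite M" if "M \<in> rcosets\<^bsub>K\<^esub> N" for M
    using that \<open>finite N\<close> by (auto simp: RCOSETS_def r_coset_def)
  then have "finite (carrier K)"
    using N K.rcosets_part_G[OF N(1)] finite_Union by metis
  then show False using assms(2) by simp
qed

text \<open>Each new subgroup also avoids a nontrivial element of every earlier one, so they are distinct.\<close>

lemma residually_finite_sequence:
  assumes K: "group K" "infinite (carrier K)" "residually_finite K" and F: "finite F"
  shows "\<exists>N :: nat \<Rightarrow> 'a set. inj N \<and> (\<forall>n. finite_index_subgroup (N n) K \<and> N n \<inter> F \<subseteq> {\<one>\<^bsub>K\<^esub>})"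
proof -
  let ?ok = "\<lambda>S. finite S \<and> S \<subseteq> carrier K - {\<one>\<^bsub>K\<^esub>}"
  have "\<exists>N x. finite_index_subgroup N K \<and> N \<inter> S = {} \<and> x \<in> N \<and> x \<in> carrier K - {\<one>\<^bsub>K\<^esub>}" if "?ok S" for S
  proof -
    obtain N where N: "finite_index_subgroup N K" "N \<inter> S = {}"
      using K(3) \<open>?ok S\<close> unfolding residually_finite_def by blast
    have "infinite (N - {\<one>\<^bsub>K\<^esub>})"
      using infinite_finite_index_subgroup[OF K(1,2) N(1)] by simp
    then obtain x where "x \<in> N - {\<one>\<^bsub>K\<^esub>}" by (metis equals0I finite.emptyI)
    moreover have "N \<subseteq> carrier K" using N subgroup.subset by (auto simp: finite_index_subgroup_def)
    ultimately show ?thesis using N by blast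
  qed
  \<comment> \<open>With the premise moved under the quantifiers, choice yields total functions
    \<open>N\<close> and \<open>x\<close> of the excluded set, which can then be iterated.\<close>
  then have "\<forall>S. \<exists>N x. ?ok S \<longrightarrow> finite_index_subgroup N K \<and> N \<inter> S = {} \<and> x \<in> N \<and> x \<in> carrier K - {\<one>\<^bsub>K\<^esub>}"
    by blast
  then obtain N x where Nx: "\<And>S. ?ok S \<Longrightarrow>
      finite_index_subgroup (N S) K \<and> N S \<inter> S = {} \<and> x S \<in> N S \<and> x S \<in> carrier K - {\<one>\<^bsub>K\<^esub>}"
    by metis
  define S where "S n = ((\<lambda>S. insert (x S) S) ^^ n) (F \<inter> carrier K - {\<one>\<^bsub>K\<^esub>})" for n
  have ok: "?ok (S n)" for n
  proof (induction n)
    case 0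
    then show ?case using F by (auto simp: S_def)
  next
    case (Suc n)
    then show ?case using Nx[OF Suc] by (simp add: S_def)
  qed
  have mono: "S m \<subseteq> S n" if "m \<le> n" for m n
    using that by (rule lift_Suc_mono_le[rotated]) (auto simp: S_def)
  have "N (S m) \<noteq> N (S n)" if "m < n" for m n
  proof -
    have "x (S m) \<in> S (Suc m)" by (simp add: S_def)
    then have "x (S m) \<in> S n" using mono[of "Suc m" n] that by auto
    then show ?thesis using Nx[OF ok[of m]] Nx[OF ok[of n]] by blast
  qed
  then have "inj (\<lambda>n. N (S n))" by (metis injI linorder_neqE_nat)
  moreover have "N (S n) \<inter> F \<subseteq> {\<one>\<^bsub>K\<^esub>}" for n
  proof -
    have "N (S n) \<subseteq> carrier K"
      using Nx[OF ok[of n]] subgroup.subset by (auto simp: finite_index_subgroup_def)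
    moreover have "F \<inter> carrier K - {\<one>\<^bsub>K\<^esub>} \<subseteq> S n" using mono[of 0 n] by (simp add: S_def)
    ultimately show ?thesis using Nx[OF ok[of n]] by blast
  qed
  ultimately show ?thesis using Nx[OF ok] by blast
qed

theorem corollary3:
  fixes G :: "('a, 'm) monoid_scheme" (structure) and X H K :: "'a set"
  assumes "group G"
    and "finite X" and "X \<subseteq> carrier G" and "generate G X = carrier G"
    and "negatively_curved G X"
    and "quasiconvex G X H" and "infinite H"
    and "quasiconvex G X K" and "infinite K"
    and "residually_finite (G\<lparr>carrier := H\<rparr>)"
    and "residually_finite (G\<lparr>carrier := K\<rparr>)"
    and "H \<inter> K = {\<one>}"
  shows "\<exists>(Hs :: nat \<Rightarrow> 'a set) (Ks :: nat \<Rightarrow> 'a set).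
    inj Hs \<and> inj Ks \<and>
    (\<forall>m. finite_index_subgroup (Hs m) (G\<lparr>carrier := H\<rparr>)) \<and>
    (\<forall>n. finite_index_subgroup (Ks n) (G\<lparr>carrier := K\<rparr>)) \<and>
    (\<forall>m n. quasiconvex G X (generate G (Hs m \<union> Ks n)) \<and>
           generates_free_product G (Hs m) (Ks n))"
proof -
  interpret group G by fact
  interpret cayley G X using assms by unfold_locales auto
  obtain \<delta> where "0 \<le> \<delta>" "delta_negatively_curved G X \<delta>"
    using assms(5) unfolding negatively_curved_def by blast
  then interpret hyperbolic_space "carrier G" "\<lambda>a b. real (cayley_dist G X a b)" "2 * \<delta> + 1"
    using negatively_curved_hyperbolic_space by blast
  interpret hyperbolic_group G X "2 * \<delta> + 1" by unfold_locales
  obtain C where C: "0 \<le> C" "\<And>h k. h \<in> H \<Longrightarrow> k \<in> K \<Longrightarrow> gromov h k \<one> \<le> C"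
    using gromov_bounded[OF assms(6,8,12)] by blast
  \<comment> \<open>The final 1 makes the inequality required of \<open>L\<close> strict.
    \<open>F\<close> below is a ball of radius at least \<open>L\<close>, so a nontrivial element of
    a subgroup meeting \<open>F\<close> at most in \<open>\<one>\<close> is longer than
    \<open>L\<close>.\<close>
  define L where "L = 2 * C + 3 * (2 * \<delta> + 1) + 1"
  define F where "F = {g \<in> carrier G. cdist \<one> g \<le> nat \<lceil>L\<rceil>}"
  have F: "finite F" unfolding F_def by (rule finite_ball)
  have sub: "subgroup H G" "subgroup K G" using assms by (auto simp: quasiconvex_def)
  have "\<exists>N :: nat \<Rightarrow> 'a set. inj N \<and> (\<forall>n. finite_index_subgroup (N n) (G\<lparr>carrier := H\<rparr>) \<and> N n \<inter> F \<subseteq> {\<one>})"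
    using residually_finite_sequence[OF subgroup_imp_group[OF sub(1)] _ assms(10) F] assms(7) by simp
  then obtain Hs :: "nat \<Rightarrow> 'a set" where Hs: "inj Hs" "\<And>m. finite_index_subgroup (Hs m) (G\<lparr>carrier := H\<rparr>)"
      "\<And>m. Hs m \<inter> F \<subseteq> {\<one>}" by blast
  have "\<exists>N :: nat \<Rightarrow> 'a set. inj N \<and> (\<forall>n. finite_index_subgroup (N n) (G\<lparr>carrier := K\<rparr>) \<and> N n \<inter> F \<subseteq> {\<one>})"
    using residually_finite_sequence[OF subgroup_imp_group[OF sub(2)] _ assms(11) F] assms(9) by simp
  then obtain Ks :: "nat \<Rightarrow> 'a set" where Ks: "inj Ks" "\<And>n. finite_index_subgroup (Ks n) (G\<lparr>carrier := K\<rparr>)"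
      "\<And>n. Ks n \<inter> F \<subseteq> {\<one>}" by blast
  have long: "L \<le> rdist \<one> g" if "g \<in> N" "g \<noteq> \<one>" "N \<inter> F \<subseteq> {\<one>}" "subgroup N G" for g N
  proof -
    have "\<not> cdist \<one> g \<le> nat \<lceil>L\<rceil>" using that subgroup.mem_carrier[OF that(4)] by (auto simp: F_def)
    then show ?thesis by linarith
  qed
  have "quasiconvex G X (generate G (Hs m \<union> Ks n)) \<and> generates_free_product G (Hs m) (Ks n)" for m n
  proof -
    have sHK: "subgroup (Hs m) (G\<lparr>carrier := H\<rparr>)" "subgroup (Ks n) (G\<lparr>carrier := K\<rparr>)"
      using Hs(2) Ks(2) by (auto simp: finite_index_subgroup_def)
    have s: "subgroup (Hs m) G" "subgroup (Ks n) G"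
      using incl_subgroup[OF sub(1) sHK(1)] incl_subgroup[OF sub(2) sHK(2)] by auto
    have "Hs m \<subseteq> H" "Ks n \<subseteq> K" using subgroup.subset[OF sHK(1)] subgroup.subset[OF sHK(2)] by auto
    then have g: "\<And>a b. a \<in> Hs m \<Longrightarrow> b \<in> Ks n \<Longrightarrow> gromov a b \<one> \<le> C" using C(2) by blast
    have L: "2 * C + 3 * (2 * \<delta> + 1) < L" by (simp add: L_def)
    note long' = long[OF _ _ Hs(3) s(1)] long[OF _ _ Ks(3) s(2)]
    show ?thesis
      using long_subgroups_quasiconvex[OF s C(1) g L long' quasiconvex_finite_index[OF assms(6) Hs(2)]
          quasiconvex_finite_index[OF assms(8) Ks(2)]]
        long_subgroups_free_product[OF s C(1) g L long'] by blast
  qed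
  then show ?thesis using Hs Ks by blast
qed

end
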